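(* Let $T$ be a complete continuous theory with $NIP$. Then for every model $M$ of $T$, every formula $\phi(x;y)$ and all $r<s\le1$, there is a natural number $n$ such that there are no average measures $\mu_1,\ldots,\mu_n$ of elements of $M$ which are shattered by elements in $M$ for $\phi(x;y)$ and $r<s$; i.e. there are no $\mu_1,\dots,\mu_n$ such that for every $I\subseteq\{1,\dots,n\}$ there is $b_I\in M$ with $\mu_i(\phi(x;b_I))\le r$ for $i\in I$ and $\mu_i(\phi(x;b_I))\ge s$ for $i\notin I$.
   Context: Formulas of the continuous theory take values in $[0,1]$. For $a_1,\dots,a_k\in M$, the average measure ${\rm Ave}(a_1,\dots,a_k)$ assigns to $\phi(x;b)$ the value $\frac1k\sum_{j=1}^k\phi(a_j;b)$. A continuous formula $\varphi(x;y)$ has $IP$ if there are $r<s\le1$ and $(a_i:i<\omega)$ in the monster model such that for each $I\subseteq\mathbb N$ there is $b$ with $\varphi(a_i;b)\le r$ for $i\in I$ and $\ge s$ for $i\notin I$; $T$ has $NIP$ if no formula has $IP$. *)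

theory Defs
  imports "HOL-Analysis.Analysis"
begin

unbundle cardinal_syntax

section \<open>Signatures, terms and formulas of continuous logic\<close>

text \<open>
  One-sorted continuous logic of bounded metric structures (Ben Yaacov, Berenstein, Henson, Usvyatsov).
  The symbols form subsets of the types \<open>'f\<close> and \<open>'p\<close>, so a signature may have no
  function symbols or no predicate symbols besides the metric. Constants are function symbols
  of arity \<open>0\<close>. The signature prescribes the moduli of uniform continuity.
\<close>

record ('f, 'p) signature =
  funs :: "'f set"
  preds :: "'p set"
  fun_arity :: "'f \<Rightarrow> nat"
  pred_arity :: "'p \<Rightarrow> nat"
  fun_modulus :: "'f \<Rightarrow> real \<Rightarrow> real"
  pred_modulus :: "'p \<Rightarrow> real \<Rightarrow> real"

definition is_modulus :: "(real \<Rightarrow> real) \<Rightarrow> bool" where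
  "is_modulus \<Delta> \<longleftrightarrow> (\<forall>\<epsilon>. 0 < \<epsilon> \<and> \<epsilon> \<le> 1 \<longrightarrow> 0 < \<Delta> \<epsilon> \<and> \<Delta> \<epsilon> \<le> 1)"

definition is_signature :: "('f, 'p) signature \<Rightarrow> bool" where
  "is_signature L \<longleftrightarrow>
     (\<forall>f\<in>funs L. is_modulus (fun_modulus L f)) \<and> (\<forall>P\<in>preds L. is_modulus (pred_modulus L P))"

datatype 'f tm = Var nat | Fun 'f "'f tm list"

text \<open>
  \<open>Conn u [\<phi>\<^sub>0, \<dots>, \<phi>\<^sub>n\<^sub>-\<^sub>1]\<close> applies an \<open>n\<close>-ary connective, i.e. a continuous
  \<open>u : [0,1]\<^sup>n \<rightarrow> [0,1]\<close>, where the cube \<open>[0,1]\<^sup>n\<close> is the set of extensional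
  functions from \<open>{..<n}\<close> to \<open>{0..1}\<close> in the product topology of \<open>nat \<Rightarrow> real\<close>.
\<close>

datatype ('f, 'p) fm =
    Dist "'f tm" "'f tm"
  | Pred 'p "'f tm list"
  | Conn "(nat \<Rightarrow> real) \<Rightarrow> real" "('f, 'p) fm list"
  | Sup_fm nat "('f, 'p) fm"
  | Inf_fm nat "('f, 'p) fm"

definition cube :: "nat \<Rightarrow> (nat \<Rightarrow> real) set" where
  "cube n = (\<Pi>\<^sub>E i\<in>{..<n}. {0..1})"

definition is_connective :: "nat \<Rightarrow> ((nat \<Rightarrow> real) \<Rightarrow> real) \<Rightarrow> bool" where
  "is_connective n u \<longleftrightarrow> continuous_on (cube n) u \<and> u ` cube n \<subseteq> {0..1}"

inductive_set terms :: "('f, 'p) signature \<Rightarrow> 'f tm set" for L :: "('f, 'p) signature" where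
  "Var v \<in> terms L"
| "f \<in> funs L \<Longrightarrow> length ts = fun_arity L f \<Longrightarrow> (\<forall>t\<in>set ts. t \<in> terms L) \<Longrightarrow> Fun f ts \<in> terms L"

inductive_set formulas :: "('f, 'p) signature \<Rightarrow> ('f, 'p) fm set" for L :: "('f, 'p) signature" where
  "t \<in> terms L \<Longrightarrow> t' \<in> terms L \<Longrightarrow> Dist t t' \<in> formulas L"
| "P \<in> preds L \<Longrightarrow> length ts = pred_arity L P \<Longrightarrow> set ts \<subseteq> terms L \<Longrightarrow> Pred P ts \<in> formulas L"
| "is_connective (length \<phi>s) u \<Longrightarrow> (\<forall>\<phi>\<in>set \<phi>s. \<phi> \<in> formulas L) \<Longrightarrow> Conn u \<phi>s \<in> formulas L"
| "\<phi> \<in> formulas L \<Longrightarrow> Sup_fm v \<phi> \<in> formulas L"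
| "\<phi> \<in> formulas L \<Longrightarrow> Inf_fm v \<phi> \<in> formulas L"

fun tm_vars :: "'f tm \<Rightarrow> nat set" where
  "tm_vars (Var v) = {v}"
| "tm_vars (Fun f ts) = (\<Union>t\<in>set ts. tm_vars t)"

fun free_vars :: "('f, 'p) fm \<Rightarrow> nat set" where
  "free_vars (Dist t t') = tm_vars t \<union> tm_vars t'"
| "free_vars (Pred P ts) = (\<Union>t\<in>set ts. tm_vars t)"
| "free_vars (Conn u \<phi>s) = (\<Union>\<phi>\<in>set \<phi>s. free_vars \<phi>)"
| "free_vars (Sup_fm v \<phi>) = free_vars \<phi> - {v}"
| "free_vars (Inf_fm v \<phi>) = free_vars \<phi> - {v}"

definition sentences :: "('f, 'p) signature \<Rightarrow> ('f, 'p) fm set" where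
  "sentences L = {\<phi> \<in> formulas L. free_vars \<phi> = {}}"

section \<open>Metric structures\<close>

record ('f, 'p, 'a) mstructure =
  univ :: "'a set"
  metric :: "'a \<Rightarrow> 'a \<Rightarrow> real"
  fun_interp :: "'f \<Rightarrow> 'a list \<Rightarrow> 'a"
  pred_interp :: "'p \<Rightarrow> 'a list \<Rightarrow> real"

definition tuples :: "'a set \<Rightarrow> nat \<Rightarrow> 'a list set" where
  "tuples A n = {a. length a = n \<and> set a \<subseteq> A}"

text \<open>The tuples \<open>a\<close>, \<open>b\<close> have distance less than \<open>\<delta>\<close> in the maximum metric.\<close>

definition close :: "('f, 'p, 'a) mstructure \<Rightarrow> real \<Rightarrow> 'a list \<Rightarrow> 'a list \<Rightarrow> bool" where
  "close M \<delta> a b \<longleftrightarrow> list_all2 (\<lambda>x y. metric M x y < \<delta>) a b"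

definition is_structure :: "('f, 'p) signature \<Rightarrow> ('f, 'p, 'a) mstructure \<Rightarrow> bool" where
  "is_structure L M \<longleftrightarrow>
     is_signature L \<and>
     univ M \<noteq> {} \<and>
     Metric_space (univ M) (metric M) \<and>
     Metric_space.mcomplete (univ M) (metric M) \<and>
     (\<forall>x\<in>univ M. \<forall>y\<in>univ M. metric M x y \<le> 1) \<and>
     (\<forall>f\<in>funs L. \<forall>a\<in>tuples (univ M) (fun_arity L f). fun_interp M f a \<in> univ M) \<and>
     (\<forall>f\<in>funs L. \<forall>\<epsilon>. 0 < \<epsilon> \<and> \<epsilon> \<le> 1 \<longrightarrow>
        (\<forall>a\<in>tuples (univ M) (fun_arity L f). \<forall>b\<in>tuples (univ M) (fun_arity L f).
           close M (fun_modulus L f \<epsilon>) a b \<longrightarrow>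
           metric M (fun_interp M f a) (fun_interp M f b) \<le> \<epsilon>)) \<and>
     (\<forall>P\<in>preds L. \<forall>a\<in>tuples (univ M) (pred_arity L P). pred_interp M P a \<in> {0..1}) \<and>
     (\<forall>P\<in>preds L. \<forall>\<epsilon>. 0 < \<epsilon> \<and> \<epsilon> \<le> 1 \<longrightarrow>
        (\<forall>a\<in>tuples (univ M) (pred_arity L P). \<forall>b\<in>tuples (univ M) (pred_arity L P).
           close M (pred_modulus L P \<epsilon>) a b \<longrightarrow>
           \<bar>pred_interp M P a - pred_interp M P b\<bar> \<le> \<epsilon>))"

fun tm_val :: "('f, 'p, 'a) mstructure \<Rightarrow> 'f tm \<Rightarrow> (nat \<Rightarrow> 'a) \<Rightarrow> 'a" where
  "tm_val M (Var v) e = e v"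
| "tm_val M (Fun f ts) e = fun_interp M f (map (\<lambda>t. tm_val M t e) ts)"

fun fm_val :: "('f, 'p, 'a) mstructure \<Rightarrow> ('f, 'p) fm \<Rightarrow> (nat \<Rightarrow> 'a) \<Rightarrow> real" where
  "fm_val M (Dist t t') e = metric M (tm_val M t e) (tm_val M t' e)"
| "fm_val M (Pred P ts) e = pred_interp M P (map (\<lambda>t. tm_val M t e) ts)"
| "fm_val M (Conn u \<phi>s) e =
     u (restrict (\<lambda>i. map (\<lambda>\<phi>. fm_val M \<phi> e) \<phi>s ! i) {..<length \<phi>s})"
| "fm_val M (Sup_fm v \<phi>) e = (SUP c\<in>univ M. fm_val M \<phi> (e(v := c)))"
| "fm_val M (Inf_fm v \<phi>) e = (INF c\<in>univ M. fm_val M \<phi> (e(v := c)))"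

text \<open>
  The assignment sending the variables \<open>xs\<close> to the entries of \<open>a\<close>; its values at other
  variables are irrelevant wherever it is used.
\<close>

definition asg :: "nat list \<Rightarrow> 'a list \<Rightarrow> nat \<Rightarrow> 'a" where
  "asg xs a v = the (map_of (zip xs a) v)"

section \<open>Theories\<close>

text \<open>
  A theory is a set of closed conditions \<open>\<phi> = 0\<close>, represented by the sentences \<open>\<phi>\<close>.
\<close>

definition models :: "('f, 'p) signature \<Rightarrow> ('f, 'p, 'a) mstructure \<Rightarrow> ('f, 'p) fm set \<Rightarrow> bool" where
  "models L M T \<longleftrightarrow> is_structure L M \<and> T \<subseteq> sentences L \<and> (\<forall>\<phi>\<in>T. fm_val M \<phi> (asg [] []) = 0)"

definition Th :: "('f, 'p) signature \<Rightarrow> ('f, 'p, 'a) mstructure \<Rightarrow> ('f, 'p) fm set" where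
  "Th L M = {\<phi> \<in> sentences L. fm_val M \<phi> (asg [] []) = 0}"

text \<open>
  A theory is complete if it is the theory of some structure; the type argument is the type
  that carries this structure.
\<close>

definition complete_theory :: "'n itself \<Rightarrow> ('f, 'p) signature \<Rightarrow> ('f, 'p) fm set \<Rightarrow> bool" where
  "complete_theory _ L T \<longleftrightarrow> (\<exists>N :: ('f, 'p, 'n) mstructure. is_structure L N \<and> T = Th L N)"

section \<open>Partitioned formulas and their instances\<close>

text \<open>\<open>\<phi>(x; y)\<close> with finite tuples of variables \<open>x = xs\<close> and \<open>y = ys\<close>.\<close>

definition partitioned :: "('f, 'p) signature \<Rightarrow> ('f, 'p) fm \<Rightarrow> nat list \<Rightarrow> nat list \<Rightarrow> bool" where
  "partitioned L \<phi> xs ys \<longleftrightarrow>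
     \<phi> \<in> formulas L \<and> distinct (xs @ ys) \<and> free_vars \<phi> \<subseteq> set (xs @ ys)"

text \<open>The triple \<open>(\<phi>, ys, b)\<close> stands for the formula with parameters \<open>\<phi>(x; b)\<close>.\<close>

type_synonym ('f, 'p, 'a) inst = "('f, 'p) fm \<times> nat list \<times> 'a list"

definition insts :: "('f, 'p) signature \<Rightarrow> 'a set \<Rightarrow> nat list \<Rightarrow> ('f, 'p, 'a) inst set" where
  "insts L A xs = {(\<phi>, ys, b). partitioned L \<phi> xs ys \<and> b \<in> tuples A (length ys)}"

definition inst_val ::
  "('f, 'p, 'a) mstructure \<Rightarrow> nat list \<Rightarrow> 'a list \<Rightarrow> ('f, 'p, 'a) inst \<Rightarrow> real" where
  "inst_val M xs a = (\<lambda>(\<phi>, ys, b). fm_val M \<phi> (asg (xs @ ys) (a @ b)))"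

section \<open>Monster models\<close>

definition saturated :: "('f, 'p) signature \<Rightarrow> 'k rel \<Rightarrow> ('f, 'p, 'u) mstructure \<Rightarrow> bool" where
  "saturated L \<kappa> U \<longleftrightarrow>
     (\<forall>A xs \<Gamma>. A \<subseteq> univ U \<and> |A| <o \<kappa> \<and> distinct xs \<and> \<Gamma> \<subseteq> insts L A xs \<and>
        (\<forall>\<Gamma>\<^sub>0. finite \<Gamma>\<^sub>0 \<and> \<Gamma>\<^sub>0 \<subseteq> \<Gamma> \<longrightarrow>
           (\<exists>a\<in>tuples (univ U) (length xs). \<forall>p\<in>\<Gamma>\<^sub>0. inst_val U xs a p = 0)) \<longrightarrow>
        (\<exists>a\<in>tuples (univ U) (length xs). \<forall>p\<in>\<Gamma>. inst_val U xs a p = 0))"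

definition elementary_on ::
  "('f, 'p) signature \<Rightarrow> ('f, 'p, 'u) mstructure \<Rightarrow> 'u set \<Rightarrow> ('u \<Rightarrow> 'u) \<Rightarrow> bool" where
  "elementary_on L U A h \<longleftrightarrow>
     h ` A \<subseteq> univ U \<and>
     (\<forall>(\<phi>, ys, b)\<in>insts L A []. inst_val U [] [] (\<phi>, ys, b) = inst_val U [] [] (\<phi>, ys, map h b))"

definition automorphism ::
  "('f, 'p) signature \<Rightarrow> ('f, 'p, 'u) mstructure \<Rightarrow> ('u \<Rightarrow> 'u) \<Rightarrow> bool" where
  "automorphism L U g \<longleftrightarrow>
     bij_betw g (univ U) (univ U) \<and>
     (\<forall>x\<in>univ U. \<forall>y\<in>univ U. metric U (g x) (g y) = metric U x y) \<and>
     (\<forall>f\<in>funs L. \<forall>a\<in>tuples (univ U) (fun_arity L f).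
        g (fun_interp U f a) = fun_interp U f (map g a)) \<and>
     (\<forall>P\<in>preds L. \<forall>a\<in>tuples (univ U) (pred_arity L P).
        pred_interp U P (map g a) = pred_interp U P a)"

definition strongly_homogeneous ::
  "('f, 'p) signature \<Rightarrow> 'k rel \<Rightarrow> ('f, 'p, 'u) mstructure \<Rightarrow> bool" where
  "strongly_homogeneous L \<kappa> U \<longleftrightarrow>
     (\<forall>A h. A \<subseteq> univ U \<and> |A| <o \<kappa> \<and> elementary_on L U A h \<longrightarrow>
        (\<exists>g. automorphism L U g \<and> (\<forall>x\<in>A. g x = h x)))"

text \<open>
  \<open>U\<close> is a monster model of \<open>T\<close> witnessed by the cardinal \<open>\<kappa>\<close>, of which only
  \<open>\<kappa> > card(L)\<close> is asked, where \<open>card(L)\<close> is the least infinite cardinal not smaller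
  than the number of symbols.
\<close>

definition monster_model ::
  "('f, 'p) signature \<Rightarrow> ('f, 'p) fm set \<Rightarrow> 'k rel \<Rightarrow> ('f, 'p, 'u) mstructure \<Rightarrow> bool" where
  "monster_model L T \<kappa> U \<longleftrightarrow>
     Card_order \<kappa> \<and> natLeq <o \<kappa> \<and> |funs L <+> preds L| <o \<kappa> \<and>
     models L U T \<and> saturated L \<kappa> U \<and> strongly_homogeneous L \<kappa> U"

section \<open>The independence property\<close>

definition has_IP :: "('f, 'p, 'u) mstructure \<Rightarrow> ('f, 'p) fm \<Rightarrow> nat list \<Rightarrow> nat list \<Rightarrow> bool" where
  "has_IP U \<phi> xs ys \<longleftrightarrow>
     (\<exists>r s :: real. r < s \<and> s \<le> 1 \<and>
       (\<exists>a :: nat \<Rightarrow> 'u list. (\<forall>i. a i \<in> tuples (univ U) (length xs)) \<and>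
         (\<forall>I :: nat set. \<exists>b\<in>tuples (univ U) (length ys).
            (\<forall>i\<in>I. inst_val U xs (a i) (\<phi>, ys, b) \<le> r) \<and>
            (\<forall>i. i \<notin> I \<longrightarrow> s \<le> inst_val U xs (a i) (\<phi>, ys, b)))))"

text \<open>The theory with monster model \<open>U\<close> has NIP.\<close>

definition NIP :: "('f, 'p) signature \<Rightarrow> ('f, 'p, 'u) mstructure \<Rightarrow> bool" where
  "NIP L U \<longleftrightarrow> (\<forall>\<phi> xs ys. partitioned L \<phi> xs ys \<longrightarrow> \<not> has_IP U \<phi> xs ys)"

section \<open>Average measures\<close>

definition Ave ::
  "('f, 'p, 'a) mstructure \<Rightarrow> nat list \<Rightarrow> 'a list list \<Rightarrow> ('f, 'p, 'a) inst \<Rightarrow> real" where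
  "Ave M xs as = (\<lambda>p. (1 / real (length as)) * (\<Sum>j<length as. inst_val M xs (as ! j) p))"

definition average_measures ::
  "('f, 'p, 'a) mstructure \<Rightarrow> nat list \<Rightarrow> (('f, 'p, 'a) inst \<Rightarrow> real) set" where
  "average_measures M xs = {Ave M xs as | as. as \<noteq> [] \<and> set as \<subseteq> tuples (univ M) (length xs)}"

text \<open>The measures \<open>\<mu> 1, \<dots>, \<mu> n\<close> are shattered by elements of \<open>M\<close> for \<open>\<phi>(x; y)\<close> and \<open>r < s\<close>.\<close>

definition shattered ::
  "('f, 'p, 'a) mstructure \<Rightarrow> ('f, 'p) fm \<Rightarrow> nat list \<Rightarrow> real \<Rightarrow> real \<Rightarrow> nat \<Rightarrow>
   (nat \<Rightarrow> ('f, 'p, 'a) inst \<Rightarrow> real) \<Rightarrow> bool" where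
  "shattered M \<phi> ys r s n \<mu> \<longleftrightarrow>
     (\<forall>I. I \<subseteq> {1..n} \<longrightarrow>
       (\<exists>b\<in>tuples (univ M) (length ys).
          (\<forall>i\<in>I. \<mu> i (\<phi>, ys, b) \<le> r) \<and>
          (\<forall>i\<in>{1..n} - I. s \<le> \<mu> i (\<phi>, ys, b))))"

end

theory Submission
  imports Defs "HOL-Real_Asymp.Real_Asymp"
begin

text \<open>
  Suppose that averages \<open>\<mu>\<^sub>1, \<dots>, \<mu>\<^sub>n\<close> are shattered for every \<open>n\<close>, by parameters \<open>b\<^sub>P\<close> indexed by the
  sign patterns \<open>P\<close>. The correlation of the sign of \<open>i\<close> in \<open>P\<close> with \<open>\<mu>\<^sub>i(\<phi>(x; b\<^sub>P))\<close> is bounded away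
  from \<open>0\<close> and is linear in \<open>\<mu>\<^sub>i\<close>, so every \<open>\<mu>\<^sub>i\<close> can be replaced by a single point \<open>x\<^sub>i\<close>. By an
  exponential moment bound, the vectors \<open>(\<phi>(x\<^sub>i; b\<^sub>P))\<^sub>i\<close> then do not admit a sup-norm net of
  subexponential size. If no large set of points were shattered, the combinatorial lemma of Alon,
  Ben-David, Cesa-Bianchi and Haussler would give such a net, of size \<open>n\<close> to the power
  \<open>O(log n)\<close>. Hence for some \<open>r' < s'\<close> arbitrarily large finite sets of points of \<open>M\<close> are
  shattered by \<open>\<phi>\<close>, and elementary equivalence with saturation turns this into the independence
  property in the monster model.
\<close>

section \<open>Combinatorial dimension of finite families of integer-valued functions\<close>

section \<open>Separated families of discrete functions\<close>

text \<open>A gap of 2, not of 1, leaves an integer strictly between the two values, which can then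
  serve as a threshold.\<close>

definition separated_on :: "'i set \<Rightarrow> ('i \<Rightarrow> nat) set \<Rightarrow> bool" where
  "separated_on J G \<longleftrightarrow> (\<forall>f\<in>G. \<forall>g\<in>G. f \<noteq> g \<longrightarrow> (\<exists>i\<in>J. f i + 2 \<le> g i \<or> g i + 2 \<le> f i))"

text \<open>The domain of \<open>t\<close> is the shattered set of coordinates and its values are
  the thresholds. Both inequalities are strict, so that after rescaling a threshold becomes an
  interval of positive width.\<close>

definition strongly_shatters :: "('i \<Rightarrow> nat) set \<Rightarrow> ('i \<rightharpoonup> nat) \<Rightarrow> bool" where
  "strongly_shatters G t \<longleftrightarrow>
     (\<forall>E. \<exists>f\<in>G. \<forall>i w. t i = Some w \<longrightarrow> (if i \<in> E then w < f i else f i < w))"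

text \<open>Bounding the thresholds by \<open>K\<close> makes this set finite; the argument counts
  its elements instead of maximising a domain directly.\<close>

definition shattered_maps :: "'i set \<Rightarrow> nat \<Rightarrow> ('i \<Rightarrow> nat) set \<Rightarrow> ('i \<rightharpoonup> nat) set" where
  "shattered_maps J K G = {t. dom t \<subseteq> J \<and> ran t \<subseteq> {..<K} \<and> strongly_shatters G t}"

lemma finite_partial_maps:
  assumes "finite A" "finite B"
  shows "finite {t. dom t \<subseteq> A \<and> ran t \<subseteq> B}"
proof -
  have "{t. dom t \<subseteq> A \<and> ran t \<subseteq> B} = (\<Union>D\<in>Pow A. {t. dom t = D \<and> ran t \<subseteq> B})" by auto
  then show ?thesis
    using assms by (auto intro!: finite_set_of_finite_maps intro: finite_subset)
qed

lemma finite_shattered_maps: "finite J \<Longrightarrow> finite (shattered_maps J K G)"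
  by (rule finite_subset[OF _ finite_partial_maps[of J "{..<K}"]])
    (auto simp: shattered_maps_def)

lemma strongly_shatters_mono: "strongly_shatters G t \<Longrightarrow> G \<subseteq> H \<Longrightarrow> strongly_shatters H t"
  unfolding strongly_shatters_def by blast

text \<open>A pattern that contains \<open>x\<close> is realised inside \<open>G2\<close>, any other
  one inside \<open>G1\<close>; each family realises the pattern on the old coordinates.\<close>

lemma strongly_shatters_upd:
  assumes "strongly_shatters G1 t" "strongly_shatters G2 t" "G1 \<subseteq> G" "G2 \<subseteq> G"
    and "\<And>f. f \<in> G1 \<Longrightarrow> f x < w" "\<And>f. f \<in> G2 \<Longrightarrow> w < f x"
  shows "strongly_shatters G (t(x \<mapsto> w))"
  unfolding strongly_shatters_def
proof
  fix E
  obtain f1 where f1: "f1 \<in> G1" "\<forall>i w. t i = Some w \<longrightarrow> (if i \<in> E then w < f1 i else f1 i < w)"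
    using assms(1) unfolding strongly_shatters_def by blast
  obtain f2 where f2: "f2 \<in> G2" "\<forall>i w. t i = Some w \<longrightarrow> (if i \<in> E then w < f2 i else f2 i < w)"
    using assms(2) unfolding strongly_shatters_def by blast
  show "\<exists>f\<in>G. \<forall>i v. (t(x \<mapsto> w)) i = Some v \<longrightarrow> (if i \<in> E then v < f i else f i < v)"
  proof (cases "x \<in> E")
    case True
    then show ?thesis using f2 assms(4,6) by (intro bexI[of _ f2]) auto
  next
    case False
    then show ?thesis using f1 assms(3,5) by (intro bexI[of _ f1]) auto
  qed
qed

text \<open>A map shattered by exactly one of the families counts once. A map shattered by both
  counts twice, and its second copy is the extension by the threshold \<open>Suc u\<close> at
  \<open>x\<close>, which lies strictly between \<open>u\<close> and \<open>v\<close>.\<close>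

lemma card_shattered_maps_split:
  assumes "finite J" "x \<in> J" "G1 \<subseteq> G" "G2 \<subseteq> G" "u + 2 \<le> v" "v < K"
    and "\<And>f. f \<in> G1 \<Longrightarrow> f x = u" "\<And>f. f \<in> G2 \<Longrightarrow> f x = v"
  shows "card (shattered_maps (J - {x}) K G1) + card (shattered_maps (J - {x}) K G2)
           \<le> card (shattered_maps J K G)"
proof -
  let ?A = "shattered_maps (J - {x}) K G1" and ?B = "shattered_maps (J - {x}) K G2"
  let ?up = "\<lambda>t :: 'a \<rightharpoonup> nat. t(x \<mapsto> Suc u)"
  have fin: "finite ?A" "finite ?B" using assms(1) by (auto intro: finite_shattered_maps)
  have x: "t x = None" if "t \<in> ?A \<union> ?B" for t
    using that by (auto simp: shattered_maps_def)
  have inj: "inj_on ?up (?A \<inter> ?B)"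
  proof (rule inj_onI)
    fix t t' assume t: "t \<in> ?A \<inter> ?B" "t' \<in> ?A \<inter> ?B" and eq: "?up t = ?up t'"
    have "t i = t' i" for i
      using fun_cong[OF eq, of i] x[of t] x[of t'] t by (cases "i = x") auto
    then show "t = t'" by blast
  qed
  have disj: "(?A \<union> ?B) \<inter> ?up ` (?A \<inter> ?B) = {}"
    using x by (force simp: fun_eq_iff)
  have "card ?A + card ?B = card (?A \<union> ?B) + card (?A \<inter> ?B)"
    using fin by (rule card_Un_Int)
  also have "\<dots> = card ((?A \<union> ?B) \<union> ?up ` (?A \<inter> ?B))"
    using fin inj disj by (subst card_Un_disjoint[OF _ _ disj]) (auto simp: card_image)
  also have "\<dots> \<le> card (shattered_maps J K G)"
  proof (rule card_mono)
    show "finite (shattered_maps J K G)" using assms(1) by (rule finite_shattered_maps)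
    have "?A \<union> ?B \<subseteq> shattered_maps J K G"
      using assms(3,4) by (auto simp: shattered_maps_def intro: strongly_shatters_mono)
    moreover have "?up t \<in> shattered_maps J K G" if "t \<in> ?A" "t \<in> ?B" for t
    proof -
      have "strongly_shatters G (?up t)"
        using that assms by (intro strongly_shatters_upd[of G1 t G2]) (auto simp: shattered_maps_def)
      moreover have "ran (?up t) \<subseteq> {..<K}"
        using that x[of t] assms(5,6) by (auto simp: shattered_maps_def)
      ultimately show ?thesis using that assms(2) by (auto simp: shattered_maps_def)
    qed
    ultimately show "(?A \<union> ?B) \<union> ?up ` (?A \<inter> ?B) \<subseteq> shattered_maps J K G" by auto
  qed
  finally show ?thesis .
qed

text \<open>Functions with a common value at \<open>x\<close> must be separated at some other
  coordinate.\<close>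

lemma separated_on_fibre:
  assumes "separated_on J G" "H \<subseteq> G" "\<And>f. f \<in> H \<Longrightarrow> f x = u"
  shows "separated_on (J - {x}) H"
  unfolding separated_on_def
proof (intro ballI impI)
  fix f g assume fg: "f \<in> H" "g \<in> H" "f \<noteq> g"
  then obtain i where i: "i \<in> J" "f i + 2 \<le> g i \<or> g i + 2 \<le> f i"
    using assms(1,2) unfolding separated_on_def by blast
  then have "i \<noteq> x" using assms(3)[of f] assms(3)[of g] fg by auto
  then show "\<exists>i\<in>J - {x}. f i + 2 \<le> g i \<or> g i + 2 \<le> f i" using i by blast
qed

text \<open>
  The double counting of Alon, Ben-David, Cesa-Bianchi and Haussler: among many disjoint pairs of
  functions, a popular coordinate and pair of values splits off two subfamilies that are both large.
\<close>

lemma card_shattered_maps_ge: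
  fixes G :: "('i \<Rightarrow> nat) set"
  assumes "0 < n" "0 < K"
    and "finite J" "card J \<le> n" "finite G" "separated_on J G"
    and "\<And>f i. f \<in> G \<Longrightarrow> i \<in> J \<Longrightarrow> f i < K"
    and "(2 * n * K\<^sup>2) ^ r \<le> card G" "G \<noteq> {}"
  shows "2 ^ r \<le> card (shattered_maps J K G)"
  using assms(3-)
proof (induction r arbitrary: J G)
  case 0
  have "Map.empty \<in> shattered_maps J K G"
    using 0 by (auto simp: shattered_maps_def strongly_shatters_def)
  then have "card (shattered_maps J K G) \<noteq> 0"
    using finite_shattered_maps[OF 0(1)] by auto
  then show ?case by simp
next
  case (Suc r)
  \<comment> \<open>\<open>N\<close> bounds the number of triples of a coordinate and two values, so
    among \<open>N * h\<close> pairs at least \<open>h\<close> share a triple. The pairs are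
    disjoint and thus consume \<open>2 * (N * h)\<close> functions.\<close>
  define N where "N = n * K\<^sup>2"
  define h where "h = (2 * N) ^ r"
  have N: "(2 * n * K\<^sup>2) ^ r = h" "(2 * n * K\<^sup>2) ^ Suc r = 2 * (N * h)"
    by (simp_all add: N_def h_def mult_ac)
  have "N > 0" "h > 0" using assms(1,2) by (auto simp: N_def h_def)
  obtain e where e: "bij_betw e {..<card G} G"
    using ex_bij_betw_nat_finite[OF \<open>finite G\<close>] by (auto simp: atLeast0LessThan)
  let ?m = "N * h"
  have m: "2 * ?m \<le> card G" using Suc.prems(6) N(2) by linarith
  \<comment> \<open>Function \<open>k\<close> of the enumeration is paired with function
    \<open>?m + k\<close>.\<close>
  have eG: "e k \<in> G" "e (?m + k) \<in> G" if "k < ?m" for k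
    using e that m by (auto simp: bij_betw_def)
  have ne: "e k \<noteq> e (?m + k)" if "k < ?m" for k
  proof
    assume "e k = e (?m + k)"
    then have "k = ?m + k" using e that m by (intro inj_onD[of e "{..<card G}"]) (auto simp: bij_betw_def)
    then show False using that by linarith
  qed
  have "\<exists>i\<in>J. e k i + 2 \<le> e (?m + k) i \<or> e (?m + k) i + 2 \<le> e k i" if "k < ?m" for k
    using Suc.prems(4) eG[OF that] ne[OF that] unfolding separated_on_def by blast
  then obtain i where i: "\<And>k. k < ?m \<Longrightarrow> i k \<in> J"
    "\<And>k. k < ?m \<Longrightarrow> e k (i k) + 2 \<le> e (?m + k) (i k) \<or> e (?m + k) (i k) + 2 \<le> e k (i k)"
    by metis
  define c where "c k = (i k, e k (i k), e (?m + k) (i k))" for k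
  have "card (J \<times> {..<K} \<times> {..<K}) * h \<le> card {..<?m}"
    using Suc.prems(2) by (simp add: card_cartesian_product N_def power2_eq_square)
  moreover have "c ` {..<?m} \<subseteq> J \<times> {..<K} \<times> {..<K}"
    using i(1) eG Suc.prems(5) by (auto simp: c_def)
  ultimately obtain y where y: "y \<in> J \<times> {..<K} \<times> {..<K}" "h \<le> card {k\<in>{..<?m}. c k = y}"
  proof -
    let ?B = "J \<times> {..<K} \<times> {..<K}"
    assume *: "card ?B * h \<le> card {..<?m}" "c ` {..<?m} \<subseteq> ?B"
    have "0 < ?m" using \<open>N > 0\<close> \<open>h > 0\<close> by simp
    then have "?B \<noteq> {}" using *(2) by blast
    moreover have "finite ?B" using Suc.prems(1) by simp
    ultimately obtain y where y: "y \<in> ?B" "card {..<?m} \<le> card (c -` {y} \<inter> {..<?m}) * card ?B"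
      using pigeonhole_card[of c "{..<?m}" ?B] *(2) by blast
    have "0 < card ?B" using \<open>?B \<noteq> {}\<close> \<open>finite ?B\<close> card_gt_0_iff by blast
    moreover have "card ?B * h \<le> card ?B * card (c -` {y} \<inter> {..<?m})"
      using *(1) y(2) by (simp only: mult.commute)
    ultimately have "h \<le> card (c -` {y} \<inter> {..<?m})" by (simp only: mult_le_cancel1)
    also have "c -` {y} \<inter> {..<?m} = {k\<in>{..<?m}. c k = y}" by auto
    finally show ?thesis using that y(1) by blast
  qed
  obtain x u v where xuv: "y = (x, u, v)" "x \<in> J" "u < K" "v < K" using y(1) by auto
  let ?S = "{k\<in>{..<?m}. c k = y}"
  define G1 where "G1 = e ` ?S"
  define G2 where "G2 = (\<lambda>k. e (?m + k)) ` ?S"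
  have sub: "G1 \<subseteq> G" "G2 \<subseteq> G" using eG by (auto simp: G1_def G2_def)
  have inj_e: "inj_on e {..<card G}" using e by (simp add: bij_betw_def)
  have "inj_on e ?S" using inj_e by (rule inj_on_subset) (use m in auto)
  moreover have "inj_on (\<lambda>k. e (?m + k)) ?S"
  proof (rule inj_onI)
    fix k l assume "k \<in> ?S" "l \<in> ?S" "e (?m + k) = e (?m + l)"
    then have "?m + k = ?m + l" using m by (intro inj_onD[OF inj_e]) auto
    then show "k = l" by simp
  qed
  ultimately have inj: "inj_on e ?S" "inj_on (\<lambda>k. e (?m + k)) ?S" .
  have card: "h \<le> card G1" "h \<le> card G2"
    using y(2) inj by (simp_all add: G1_def G2_def card_image)
  have G1x: "f x = u" if "f \<in> G1" for f using that xuv by (auto simp: G1_def c_def)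
  have G2x: "f x = v" if "f \<in> G2" for f using that xuv by (auto simp: G2_def c_def)
  have uv: "u + 2 \<le> v \<or> v + 2 \<le> u"
  proof -
    have "?S \<noteq> {}" using y(2) \<open>h > 0\<close> by (metis card.empty not_less)
    then obtain k where "k < ?m" "c k = y" by auto
    then show ?thesis using i(2)[of k] xuv by (auto simp: c_def)
  qed
  \<comment> \<open>Only \<open>card J \<le> n\<close> is assumed, so the same \<open>n\<close>, and
    with it the same \<open>h\<close>, still serves after \<open>x\<close> is removed.\<close>
  have IH: "2 ^ r \<le> card (shattered_maps (J - {x}) K H)"
    if "H \<subseteq> G" "h \<le> card H" "\<And>f. f \<in> H \<Longrightarrow> f x = w" for H w
  proof (rule Suc.IH)
    show "card (J - {x}) \<le> n" using Suc.prems(2) by (meson card_Diff1_le le_trans)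
    show "finite H" using that(1) Suc.prems(3) by (rule finite_subset)
    show "separated_on (J - {x}) H" using Suc.prems(4) that(1,3) by (rule separated_on_fibre)
    show "(2 * n * K\<^sup>2) ^ r \<le> card H" using that(2) N by simp
    show "H \<noteq> {}" using that(2) \<open>h > 0\<close> by auto
  qed (use that Suc.prems in auto)
  have "card (shattered_maps (J - {x}) K G1) + card (shattered_maps (J - {x}) K G2)
         \<le> card (shattered_maps J K G)"
    using uv
  proof
    assume "u + 2 \<le> v"
    then show ?thesis
      using card_shattered_maps_split[OF Suc.prems(1) xuv(2) sub _ xuv(4)] G1x G2x by blast
  next
    assume "v + 2 \<le> u"
    then show ?thesis
      using card_shattered_maps_split[OF Suc.prems(1) xuv(2) sub(2,1) _ xuv(3)] G1x G2x
      by (simp add: add.commute)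
  qed
  then show ?case
    using IH[OF sub(1) card(1), of u] IH[OF sub(2) card(2), of v] G1x G2x by simp
qed

text \<open>A subset with at most \<open>d\<close> elements is the content of a list of length
  \<open>d\<close> padded with \<open>None\<close>.\<close>

lemma card_bounded_subsets_le:
  assumes "finite S"
  shows "card {A. A \<subseteq> S \<and> card A \<le> d} \<le> (card S + 1) ^ d"
proof -
  let ?S = "insert None (Some ` S)"
  have "{A. A \<subseteq> S \<and> card A \<le> d} \<subseteq> (\<lambda>l. {a. Some a \<in> set l}) ` {l. set l \<subseteq> ?S \<and> length l = d}"
  proof
    fix A assume A: "A \<in> {A. A \<subseteq> S \<and> card A \<le> d}"
    then have "finite A" using assms by (auto intro: finite_subset)
    then obtain l where l: "set l = A" "distinct l" using finite_distinct_list by blast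
    then have "length l = card A" by (metis distinct_card)
    then show "A \<in> (\<lambda>l. {a. Some a \<in> set l}) ` {l. set l \<subseteq> ?S \<and> length l = d}"
      using A l by (intro image_eqI[of _ _ "map Some l @ replicate (d - length l) None"]) auto
  qed
  then have "card {A. A \<subseteq> S \<and> card A \<le> d} \<le> card {l. set l \<subseteq> ?S \<and> length l = d}"
    using assms by (intro surj_card_le finite_lists_length_eq) auto
  also have "\<dots> = (card S + 1) ^ d"
    using assms by (subst card_lists_length_eq) (auto simp: card_image)
  finally show ?thesis .
qed

text \<open>A partial map is determined by its graph, a subset of \<open>J \<times> {..<K}\<close>
  no larger than the domain.\<close>

lemma card_small_maps_le:
  assumes "finite J"
  shows "card {t. dom t \<subseteq> J \<and> ran t \<subseteq> {..<K} \<and> card (dom t) \<le> d} \<le> (card J * K + 1) ^ d"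
proof -
  let ?T = "{t. dom t \<subseteq> J \<and> ran t \<subseteq> {..<K} \<and> card (dom t) \<le> d}"
  have "inj_on Map.graph ?T"
  proof (rule inj_onI)
    fix t t' :: "'a \<rightharpoonup> nat" assume "Map.graph t = Map.graph t'"
    then have "t i = Some w \<longleftrightarrow> t' i = Some w" for i w
      by (metis in_graphD in_graphI)
    then show "t = t'" by (metis option.exhaust ext)
  qed
  moreover have "Map.graph ` ?T \<subseteq> {A. A \<subseteq> J \<times> {..<K} \<and> card A \<le> d}"
  proof (rule image_subsetI)
    fix t assume t: "t \<in> ?T"
    have "Map.graph t = (\<lambda>i. (i, the (t i))) ` dom t"
      by (auto simp: Map.graph_def dom_def image_iff)
    moreover have "finite (dom t)" using t assms by (auto intro: finite_subset)
    ultimately have "card (Map.graph t) \<le> card (dom t)" by (simp add: card_image_le)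
    then show "Map.graph t \<in> {A. A \<subseteq> J \<times> {..<K} \<and> card A \<le> d}"
      using t by (auto simp: Map.graph_def ran_def)
  qed
  ultimately have "card ?T \<le> card {A. A \<subseteq> J \<times> {..<K} \<and> card A \<le> d}"
    using assms by (intro card_inj_on_le[of Map.graph]) auto
  also have "\<dots> \<le> (card (J \<times> {..<K}) + 1) ^ d"
    using assms by (intro card_bounded_subsets_le) auto
  finally show ?thesis by (simp add: card_cartesian_product)
qed

text \<open>There are more shattered maps than maps with a domain of size at most \<open>d\<close>.
  Powers of two reduce the comparison of the two counts to their exponents.\<close>

lemma exists_large_shattered_map:
  assumes "finite J" "card J = 2 ^ m" "finite G" "separated_on J G"
    and "\<And>f i. f \<in> G \<Longrightarrow> i \<in> J \<Longrightarrow> f i < 2 ^ p"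
    and "2 ^ ((m + 2 * p + 1) * ((m + p + 1) * d + 1)) \<le> card G"
  obtains t where "dom t \<subseteq> J" "ran t \<subseteq> {..<2 ^ p}" "strongly_shatters G t" "d < card (dom t)"
proof -
  \<comment> \<open>One more than the exponent that bounds the number of maps with small
    domain.\<close>
  define q where "q = (m + p + 1) * d + 1"
  have "(2 * 2 ^ m * (2 ^ p)\<^sup>2 :: nat) = 2 ^ (m + 2 * p + 1)"
    by (simp add: power_add power_mult mult_ac)
  then have "(2 * 2 ^ m * (2 ^ p)\<^sup>2) ^ q = (2 ^ ((m + 2 * p + 1) * q) :: nat)"
    by (simp only: power_mult)
  then have "2 ^ q \<le> card (shattered_maps J (2 ^ p) G)"
    using assms
    by (intro card_shattered_maps_ge[of "2 ^ m"]) (auto simp: q_def)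
  moreover have "card {t. dom t \<subseteq> J \<and> ran t \<subseteq> {..<2 ^ p :: nat} \<and> card (dom t) \<le> d} < (2::nat) ^ q"
  proof -
    have "card {t. dom t \<subseteq> J \<and> ran t \<subseteq> {..<2 ^ p :: nat} \<and> card (dom t) \<le> d} \<le> (2 ^ m * 2 ^ p + 1) ^ d"
      using card_small_maps_le[OF assms(1), of "2 ^ p" d] unfolding assms(2) .
    also have "\<dots> \<le> (2 ^ (m + p + 1)) ^ d"
      by (intro power_mono) (auto simp: power_add)
    also have "\<dots> = 2 ^ ((m + p + 1) * d)" by (rule power_mult[symmetric])
    also have "\<dots> < 2 ^ q" unfolding q_def by (rule power_strict_increasing) auto
    finally show ?thesis .
  qed
  moreover have "finite {t. dom t \<subseteq> J \<and> ran t \<subseteq> {..<2 ^ p :: nat} \<and> card (dom t) \<le> d}"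
    by (rule finite_subset[OF _ finite_partial_maps[of J "{..<2 ^ p}"]])
      (use assms in auto)
  ultimately have "\<not> shattered_maps J (2 ^ p) G \<subseteq> {t. dom t \<subseteq> J \<and> ran t \<subseteq> {..<2 ^ p} \<and> card (dom t) \<le> d}"
    using card_mono[of "{t. dom t \<subseteq> J \<and> ran t \<subseteq> {..<2 ^ p :: nat} \<and> card (dom t) \<le> d}"]
    by (metis (no_types, lifting) leD le_less_trans)
  then obtain t where "t \<in> shattered_maps J (2 ^ p) G" "\<not> card (dom t) \<le> d"
    by (auto simp: shattered_maps_def)
  then show ?thesis using that[of t] by (simp add: shattered_maps_def)
qed

section \<open>Exponential moments, lower bounds for nets, and the passage from averages to
  points\<close>

section \<open>Shattered averages\<close>

text \<open>Pairs each pattern with the one that adds \<open>i\<close>, in order to compare the two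
  signs at \<open>i\<close>.\<close>

lemma sum_Pow_insert:
  fixes g :: "'i set \<Rightarrow> 'b :: comm_monoid_add"
  assumes "finite J" "i \<notin> J"
  shows "sum g (Pow (insert i J)) = (\<Sum>P\<in>Pow J. g P + g (insert i P))"
proof -
  have "inj_on (insert i) (Pow J)" using assms(2) by (auto simp: inj_on_def insert_eq_iff)
  moreover have "Pow J \<inter> insert i ` Pow J = {}" using assms(2) by auto
  ultimately show ?thesis
    using assms(1) by (simp add: Pow_insert sum.union_disjoint sum.reindex sum.distrib o_def)
qed

text \<open>The sign vector of the pattern \<open>P\<close>. Sums over \<open>Pow J\<close> are, up
  to the factor \<open>2 ^ card J\<close>, expectations over independent random signs.\<close>

definition sgn_in :: "'i set \<Rightarrow> 'i \<Rightarrow> real" where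
  "sgn_in P i = (if i \<in> P then 1 else -1)"

text \<open>For \<open>x\<close> between 0 and 1, \<open>exp x\<close> is at most
  \<open>1 + x + x\<^sup>2\<close> and \<open>exp (- x)\<close> at most
  \<open>1 - x + x\<^sup>2\<close>; the linear terms cancel. Negative \<open>x\<close> follows by
  symmetry.\<close>

lemma exp_add_exp_minus_le:
  fixes x :: real
  assumes "\<bar>x\<bar> \<le> 1"
  shows "exp x + exp (- x) \<le> 2 * exp (x\<^sup>2)"
proof -
  have *: "exp x + exp (- x) \<le> 2 * exp (x\<^sup>2)" if "0 \<le> x" "x \<le> 1" for x :: real
  proof -
    have "exp (- x) = inverse (exp x)" by (rule exp_minus)
    also have "\<dots> \<le> inverse (1 + x + x\<^sup>2 / 2)"
      using that exp_lower_Taylor_quadratic[of x] by (intro le_imp_inverse_le) (auto intro: add_pos_nonneg)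
    also have "\<dots> \<le> 1 - x + x\<^sup>2"
    proof -
      have "1 \<le> (1 - x + x\<^sup>2) * (1 + x + x\<^sup>2 / 2)"
      proof -
        have "(1 - x + x\<^sup>2) * (1 + x + x\<^sup>2 / 2) = 1 + x\<^sup>2 * (1 + x + x\<^sup>2) / 2"
          by (simp add: field_simps power2_eq_square)
        then show ?thesis using that by simp
      qed
      then show ?thesis using that
        by (simp add: inverse_eq_divide pos_divide_le_eq add_pos_nonneg)
    qed
    finally have "exp x + exp (- x) \<le> 2 * (1 + x\<^sup>2)" using exp_bound[of x] that by simp
    moreover have "1 + x\<^sup>2 \<le> exp (x\<^sup>2)" by (rule exp_ge_add_one_self)
    ultimately show ?thesis by (elim order_trans) (rule mult_left_mono, simp_all)
  qed
  show ?thesis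
    using *[of x] *[of "- x"] assms by (cases "0 \<le> x") (auto simp: add.commute)
qed

text \<open>Independence of the signs: the sum over patterns factors into a product over
  coordinates, and each factor is at most \<open>2 * exp (c\<^sup>2)\<close>.\<close>

lemma sum_exp_sgn_le:
  fixes g :: "'i \<Rightarrow> real"
  assumes "finite J" "\<And>i. i \<in> J \<Longrightarrow> \<bar>g i\<bar> \<le> 1" "0 \<le> c" "c \<le> 1"
  shows "(\<Sum>P\<in>Pow J. exp (c * (\<Sum>i\<in>J. sgn_in P i * g i))) \<le> 2 ^ card J * exp (c\<^sup>2 * card J)"
proof -
  have cg: "\<bar>c * g i\<bar> \<le> c" if "i \<in> J" for i
    using assms(2)[OF that] assms(3) by (simp add: abs_mult mult_left_le)
  have "(\<Sum>P\<in>Pow J. exp (c * (\<Sum>i\<in>J. sgn_in P i * g i)))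
      = (\<Sum>P\<in>Pow J. (\<Prod>i\<in>P. exp (c * g i)) * (\<Prod>i\<in>J - P. exp (- (c * g i))))"
  proof (rule sum.cong[OF refl])
    fix P assume "P \<in> Pow J"
    then have P: "P \<subseteq> J" "finite P" using assms(1) by (auto intro: finite_subset)
    have "(\<Sum>i\<in>J. sgn_in P i * g i) = (\<Sum>i\<in>J - P. - g i) + (\<Sum>i\<in>P. g i)"
      using P by (subst sum.subset_diff[OF P(1) assms(1)])
        (intro arg_cong2[where f = plus] sum.cong refl; simp add: sgn_in_def)
    then have "c * (\<Sum>i\<in>J. sgn_in P i * g i) = (\<Sum>i\<in>P. c * g i) + (\<Sum>i\<in>J - P. - (c * g i))"
      by (simp add: sum_distrib_left sum_negf right_diff_distrib)
    then show "exp (c * (\<Sum>i\<in>J. sgn_in P i * g i))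
        = (\<Prod>i\<in>P. exp (c * g i)) * (\<Prod>i\<in>J - P. exp (- (c * g i)))"
      using P assms(1) by (simp add: exp_add exp_sum)
  qed
  also have "\<dots> = (\<Prod>i\<in>J. exp (c * g i) + exp (- (c * g i)))"
    using assms(1) by (simp add: prod_add)
  also have "\<dots> \<le> (\<Prod>i\<in>J. 2 * exp (c\<^sup>2))"
  proof (rule prod_mono, intro conjI)
    fix i assume i: "i \<in> J"
    have "(c * g i)\<^sup>2 \<le> c\<^sup>2" using cg[OF i] assms(3) by (simp add: abs_le_square_iff[symmetric])
    then have "exp ((c * g i)\<^sup>2) \<le> exp (c\<^sup>2)" by simp
    then show "exp (c * g i) + exp (- (c * g i)) \<le> 2 * exp (c\<^sup>2)"
      using exp_add_exp_minus_le[of "c * g i"] cg[OF i] assms(4) by linarith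
  qed (simp add: add_nonneg_nonneg)
  also have "\<dots> = 2 ^ card J * exp (c\<^sup>2 * card J)"
    by (simp add: power_mult_distrib exp_of_nat_mult[symmetric] mult.commute)
  finally show ?thesis .
qed

text \<open>Approximants from the net still correlate with the patterns, so their exponential moment
  is large. A single vector has a small exponential moment against random signs, so exponentially
  many vectors are required.\<close>

lemma card_net_ge:
  fixes f :: "'i set \<Rightarrow> 'i \<Rightarrow> real"
  assumes "finite J" "finite G" "\<And>g i. g \<in> G \<Longrightarrow> i \<in> J \<Longrightarrow> \<bar>g i\<bar> \<le> 1"
    and "0 < \<delta>" "\<delta> \<le> 1"
    and net: "\<And>P. P \<subseteq> J \<Longrightarrow> \<exists>g\<in>G. \<forall>i\<in>J. \<bar>f P i - g i\<bar> \<le> \<delta>"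
    and cor: "\<And>i. i \<in> J \<Longrightarrow> 2 ^ card J * (2 * \<delta>) \<le> (\<Sum>P\<in>Pow J. sgn_in P i * f P i)"
  shows "exp (\<delta>\<^sup>2 / 4 * card J) \<le> card G"
proof -
  define n where "n = real (card J)"
  \<comment> \<open>This choice maximises \<open>c * \<delta> - c\<^sup>2\<close>.\<close>
  define c where "c = \<delta> / 2"
  obtain g where g: "\<And>P. P \<subseteq> J \<Longrightarrow> g P \<in> G" "\<And>P i. P \<subseteq> J \<Longrightarrow> i \<in> J \<Longrightarrow> \<bar>f P i - g P i\<bar> \<le> \<delta>"
    using net by metis
  define y where "y P = (\<Sum>i\<in>J. sgn_in P i * g P i)" for P
  have card_Pow: "real (card (Pow J)) = 2 ^ card J" using assms(1) by (simp add: card_Pow)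
  \<comment> \<open>Replacing \<open>f\<close> by the net costs at most \<open>\<delta>\<close> per
    pattern, half of the assumed correlation.\<close>
  have "2 ^ card J * \<delta> \<le> (\<Sum>P\<in>Pow J. sgn_in P i * g P i)" if i: "i \<in> J" for i
  proof -
    have "(\<Sum>P\<in>Pow J. sgn_in P i * f P i) \<le> (\<Sum>P\<in>Pow J. sgn_in P i * g P i + \<delta>)"
    proof (rule sum_mono)
      fix P assume "P \<in> Pow J"
      then have "\<bar>f P i - g P i\<bar> \<le> \<delta>" using g(2) i by blast
      then show "sgn_in P i * f P i \<le> sgn_in P i * g P i + \<delta>" by (simp add: sgn_in_def abs_le_iff)
    qed
    then show ?thesis using cor[OF i] card_Pow by (simp add: sum.distrib)
  qed
  then have "(\<Sum>i\<in>J. 2 ^ card J * \<delta>) \<le> (\<Sum>i\<in>J. \<Sum>P\<in>Pow J. sgn_in P i * g P i)"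
    by (rule sum_mono)
  also have "\<dots> = (\<Sum>P\<in>Pow J. y P)" unfolding y_def by (rule sum.swap)
  finally have sum_y: "2 ^ card J * (\<delta> * n) \<le> (\<Sum>P\<in>Pow J. y P)" by (simp add: n_def mult_ac)
  \<comment> \<open>Jensen's inequality, by way of the tangent of \<open>exp\<close> at
    \<open>c * (\<delta> * n)\<close>.\<close>
  have "2 ^ card J * exp (c * (\<delta> * n)) \<le> (\<Sum>P\<in>Pow J. exp (c * (\<delta> * n)) * (1 + c * (y P - \<delta> * n)))"
  proof -
    have "0 \<le> c * ((\<Sum>P\<in>Pow J. y P) - 2 ^ card J * (\<delta> * n))"
      using sum_y assms(4) by (simp add: c_def)
    then have "2 ^ card J \<le> (\<Sum>P\<in>Pow J. 1 + c * (y P - \<delta> * n))"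
      using card_Pow by (simp add: sum.distrib sum_subtractf flip: sum_distrib_left)
    then show ?thesis by (simp add: mult.commute flip: sum_distrib_left)
  qed
  also have "\<dots> \<le> (\<Sum>P\<in>Pow J. exp (c * y P))"
  proof (rule sum_mono)
    fix P
    have "exp (c * y P) = exp (c * (\<delta> * n)) * exp (c * (y P - \<delta> * n))"
      by (simp add: algebra_simps flip: exp_add)
    then show "exp (c * (\<delta> * n)) * (1 + c * (y P - \<delta> * n)) \<le> exp (c * y P)"
      by (simp add: exp_ge_add_one_self)
  qed
  \<comment> \<open>The vector \<open>g P\<close> depends on \<open>P\<close>; summing over the
    whole net removes this dependence before the moment bound is applied.\<close>
  also have "\<dots> \<le> (\<Sum>P\<in>Pow J. \<Sum>h\<in>G. exp (c * (\<Sum>i\<in>J. sgn_in P i * h i)))"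
    unfolding y_def using g(1) assms(2)
    by (intro sum_mono member_le_sum[where f = "\<lambda>h. exp (c * (\<Sum>i\<in>J. sgn_in _ i * h i))"]) auto
  also have "\<dots> = (\<Sum>h\<in>G. \<Sum>P\<in>Pow J. exp (c * (\<Sum>i\<in>J. sgn_in P i * h i)))" by (rule sum.swap)
  also have "\<dots> \<le> (\<Sum>h\<in>G. 2 ^ card J * exp (c\<^sup>2 * card J))"
    using assms by (intro sum_mono sum_exp_sgn_le) (auto simp: c_def)
  finally have "2 ^ card J * exp (c * (\<delta> * n)) \<le> 2 ^ card J * (card G * exp (c\<^sup>2 * n))"
    by (simp add: n_def mult_ac)
  then have "exp (c * (\<delta> * n)) \<le> card G * exp (c\<^sup>2 * n)" by simp
  then have "exp (c * (\<delta> * n) - c\<^sup>2 * n) \<le> card G" by (simp add: exp_diff pos_divide_le_eq)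
  also have "c * (\<delta> * n) - c\<^sup>2 * n = \<delta>\<^sup>2 / 4 * n" by (simp add: c_def power2_eq_square field_simps)
  finally show ?thesis by (simp add: n_def)
qed

text \<open>A maximal separated subfamily is also a net, since an uncovered element could be
  adjoined to it.\<close>

lemma exists_maximal_separated:
  assumes "finite A"
  obtains G where "G \<subseteq> A" "separated_on J G"
    "\<And>f. f \<in> A \<Longrightarrow> \<exists>g\<in>G. \<forall>i\<in>J. f i < g i + 2 \<and> g i < f i + 2"
proof -
  let ?\<G> = "{G. G \<subseteq> A \<and> separated_on J G}"
  have "finite ?\<G>" using assms by simp
  moreover have "{} \<in> ?\<G>" by (simp add: separated_on_def)
  ultimately have "\<exists>G\<in>?\<G>. \<forall>H\<in>?\<G>. G \<subseteq> H \<longrightarrow> G = H"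
    by (intro finite_has_maximal) auto
  then obtain G where G: "G \<in> ?\<G>" and max: "\<forall>H\<in>?\<G>. G \<subseteq> H \<longrightarrow> G = H" by (rule bexE)
  have "\<exists>g\<in>G. \<forall>i\<in>J. f i < g i + 2 \<and> g i < f i + 2" if f: "f \<in> A" for f
  proof (rule ccontr)
    assume "\<not> ?thesis"
    then have *: "\<exists>i\<in>J. f i + 2 \<le> g i \<or> g i + 2 \<le> f i" if "g \<in> G" for g
      using that by (simp add: not_less) blast
    have "\<exists>i\<in>J. g i + 2 \<le> h i \<or> h i + 2 \<le> g i" if "g \<in> insert f G" "h \<in> insert f G" "g \<noteq> h" for g h
      using that G *[of g] *[of h] unfolding separated_on_def by auto
    then have "separated_on J (insert f G)" unfolding separated_on_def by blast
    then have "insert f G \<in> ?\<G>" using G f by simp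
    then have "G = insert f G" using max by (simp add: subset_insertI)
    then have "f \<in> G" by blast
    then show False using *[of f] by auto
  qed
  then show ?thesis using that G(1) by blast
qed

text \<open>On \<open>2 ^ m\<close> coordinates the combinatorial bound has an exponent quadratic in
  \<open>m\<close>, while the exponent of the net bound grows like \<open>2 ^ m\<close>.\<close>

lemma exp_dominates_quadratic_exponent:
  fixes a :: real and p d :: nat
  assumes "0 < a"
  shows "\<exists>m::nat. 2 ^ ((m + 2 * p + 1) * ((m + p + 1) * d + 1)) \<le> exp (a * 2 ^ m)"
proof -
  have "eventually (\<lambda>m::nat. real ((m + 2 * p + 1) * ((m + p + 1) * d + 1)) * ln 2 \<le> a * 2 ^ m) at_top"
    using assms by real_asymp
  then obtain m :: nat where m: "real ((m + 2 * p + 1) * ((m + p + 1) * d + 1)) * ln 2 \<le> a * 2 ^ m"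
    using eventually_happens by fastforce
  have "2 ^ ((m + 2 * p + 1) * ((m + p + 1) * d + 1))
      = exp (real ((m + 2 * p + 1) * ((m + p + 1) * d + 1)) * ln 2)"
    by (simp only: exp_of_nat_mult) simp
  with m show ?thesis by (intro exI[of _ m]) (simp only: exp_le_cancel_iff)
qed

text \<open>The set \<open>I\<close> is the low side, as in the independence property, but opposite
  to \<open>E\<close> in \<open>strongly_shatters\<close>. The type of points is left open, so that
  lists of points under averaging are covered as well.\<close>

definition shatters_points :: "('x \<Rightarrow> 'y \<Rightarrow> real) \<Rightarrow> 'y set \<Rightarrow> real \<Rightarrow> real \<Rightarrow> 'i set \<Rightarrow> ('i \<Rightarrow> 'x) \<Rightarrow> bool" where
  "shatters_points F Y r s J a \<longleftrightarrow>
     (\<forall>I \<subseteq> J. \<exists>b\<in>Y. (\<forall>i\<in>I. F (a i) b \<le> r) \<and> (\<forall>i\<in>J - I. s \<le> F (a i) b))"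

text \<open>
  Once a parameter has been fixed for every pattern, the total correlation of the \<open>i\<close>-th average
  with the pattern is itself an average, so a single point of the \<open>i\<close>-th list does at least as well.
\<close>

lemma exists_correlated_point:
  fixes F :: "'x \<Rightarrow> 'y \<Rightarrow> real"
  assumes "finite J" "i \<in> J" "as \<noteq> []"
    and lo: "\<And>P. P \<subseteq> J \<Longrightarrow> i \<notin> P \<Longrightarrow> (1 / real (length as)) * (\<Sum>j<length as. F (as ! j) (b P)) \<le> r"
    and hi: "\<And>P. P \<subseteq> J \<Longrightarrow> i \<in> P \<Longrightarrow> s \<le> (1 / real (length as)) * (\<Sum>j<length as. F (as ! j) (b P))"
  obtains x where "x \<in> set as" "2 ^ card J * ((s - r) / 2) \<le> (\<Sum>P\<in>Pow J. sgn_in P i * F x (b P))"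
proof -
  define k where "k = length as"
  have k: "k > 0" using assms(3) by (simp add: k_def)
  define \<mu> where "\<mu> P = (1 / real k) * (\<Sum>j<k. F (as ! j) (b P))" for P
  define w where "w j = (\<Sum>P\<in>Pow J. sgn_in P i * F (as ! j) (b P))" for j
  obtain J' where J': "J = insert i J'" "i \<notin> J'" using assms(2) by (meson mk_disjoint_insert)
  then have fin: "finite J'" using assms(1) by simp
  \<comment> \<open>The patterns on \<open>J'\<close> are half of those on \<open>J\<close>; each of
    them, together with its extension by \<open>i\<close>, contributes at least
    \<open>s - r\<close>.\<close>
  have "2 ^ card J * ((s - r) / 2) = (\<Sum>P\<in>Pow J'. s - r)"
    using J' fin by (simp add: card_Pow)
  also have "\<dots> \<le> (\<Sum>P\<in>Pow J'. sgn_in P i * \<mu> P + sgn_in (insert i P) i * \<mu> (insert i P))"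
  proof (rule sum_mono)
    fix P assume P: "P \<in> Pow J'"
    then have "\<mu> P \<le> r" "s \<le> \<mu> (insert i P)"
      using lo[of P] hi[of "insert i P"] J' by (auto simp: \<mu>_def k_def)
    moreover have "i \<notin> P" using P J' by auto
    ultimately show "s - r \<le> sgn_in P i * \<mu> P + sgn_in (insert i P) i * \<mu> (insert i P)"
      by (simp add: sgn_in_def)
  qed
  also have "\<dots> = (\<Sum>P\<in>Pow J. sgn_in P i * \<mu> P)"
    using sum_Pow_insert[OF fin J'(2), of "\<lambda>P. sgn_in P i * \<mu> P"] J'(1) by simp
  also have "\<dots> = (1 / real k) * (\<Sum>P\<in>Pow J. \<Sum>j<k. sgn_in P i * F (as ! j) (b P))"
    unfolding \<mu>_def by (simp add: sum_distrib_left mult_ac)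
  also have "\<dots> = (1 / real k) * (\<Sum>j<k. w j)"
    unfolding w_def by (subst sum.swap) (rule refl)
  finally have avg: "real k * (2 ^ card J * ((s - r) / 2)) \<le> (\<Sum>j<k. w j)"
    using k by (simp add: field_simps)
  \<comment> \<open>Some \<open>w j\<close> is at least the mean.\<close>
  have "\<exists>j<k. 2 ^ card J * ((s - r) / 2) \<le> w j"
  proof (rule ccontr)
    assume "\<not> ?thesis"
    then have "(\<Sum>j<k. w j) < (\<Sum>j<k. 2 ^ card J * ((s - r) / 2))"
      using k by (intro sum_strict_mono) (auto simp: not_le)
    then show False using avg by simp
  qed
  then obtain j where "j < k" "2 ^ card J * ((s - r) / 2) \<le> w j" by blast
  then show ?thesis using that[of "as ! j"] unfolding w_def k_def by simp
qed

text \<open>Values are rounded to \<open>0, ..., B\<close>. If each of the finitely many thresholds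
  failed at some size, a maximal separated family of rounded vectors would be so large that it
  shatters more coordinates than these sizes allow.\<close>

lemma averages_shattered_imp_points_shattered:
  fixes F :: "'x \<Rightarrow> 'y \<Rightarrow> real"
  assumes F: "\<And>x y. x \<in> X \<Longrightarrow> y \<in> Y \<Longrightarrow> F x y \<in> {0..1}"
    and "r < s"
    and sh: "\<And>n. \<exists>as. (\<forall>i\<in>{1..n::nat}. as i \<noteq> [] \<and> set (as i) \<subseteq> X) \<and>
      shatters_points (\<lambda>as b. (1 / real (length as)) * (\<Sum>j<length as. F (as ! j) b)) Y r s {1..n} as"
  shows "\<exists>r' s'. 0 \<le> r' \<and> r' < s' \<and> s' \<le> 1 \<and>
    (\<forall>d. \<exists>a. (\<forall>i<d. a i \<in> X) \<and> shatters_points F Y r' s' {..<d::nat} a)"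
proof -
  \<comment> \<open>The quotient matches the correlation supplied by
    \<open>exists_correlated_point\<close>; the cap at 1 meets a hypothesis of
    \<open>card_net_ge\<close>.\<close>
  define \<delta> where "\<delta> = min 1 ((s - r) / 4)"
  have \<delta>: "0 < \<delta>" "\<delta> \<le> 1" "2 * \<delta> \<le> (s - r) / 2" using \<open>r < s\<close> by (auto simp: \<delta>_def min_def)
  \<comment> \<open>Rounding and passing to the net each cost at most \<open>1 / B\<close>, so
    \<open>2 / B\<close> must not exceed \<open>\<delta>\<close>.\<close>
  obtain B :: nat where "2 / \<delta> \<le> B" using real_arch_simple by blast
  then have B\<delta>: "2 \<le> \<delta> * B" using \<delta>(1) by (simp add: field_simps)
  then have B: "0 < B" by (cases B) auto
  \<comment> \<open>There are \<open>B\<close> candidate gaps, from \<open>w / B\<close> to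
    \<open>(w + 1) / B\<close>; one of them has to work for every \<open>d\<close>.\<close>
  define ok where "ok w d \<longleftrightarrow>
    (\<exists>a. (\<forall>i<d. a i \<in> X) \<and> shatters_points F Y (real w / B) (real (w + 1) / B) {..<d::nat} a)" for w d
  have "\<exists>w<B. \<forall>d. ok w d"
  proof (rule ccontr)
    assume "\<not> ?thesis"
    then obtain d where d: "\<And>w. w < B \<Longrightarrow> \<not> ok w (d w)" by metis
    \<comment> \<open>More than \<open>B * D\<close> shattered coordinates force some threshold
      \<open>w\<close> to occur on at least \<open>D\<close>, hence on at least \<open>d w\<close>,
      of them.\<close>
    define D where "D = (\<Sum>w<B. d w)"
    have dD: "d w \<le> D" if "w < B" for w
      unfolding D_def using that by (intro member_le_sum) auto
    \<comment> \<open>As an exponent, \<open>B\<close> stands for the range \<open>2 ^ B\<close>, a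
      crude power of two above all values \<open>0, ..., B\<close>.\<close>
    obtain m :: nat where m: "2 ^ ((m + 2 * B + 1) * ((m + B + 1) * (B * D) + 1)) \<le> exp (\<delta>\<^sup>2 / 4 * 2 ^ m)"
      using exp_dominates_quadratic_exponent[of "\<delta>\<^sup>2 / 4" B "B * D"] \<delta>(1) by auto
    define J where "J = {1..(2::nat) ^ m}"
    have J: "finite J" "card J = 2 ^ m" by (auto simp: J_def)
    obtain as where as: "\<And>i. i \<in> J \<Longrightarrow> as i \<noteq> []" "\<And>i. i \<in> J \<Longrightarrow> set (as i) \<subseteq> X"
      and shat: "shatters_points (\<lambda>as b. (1 / real (length as)) * (\<Sum>j<length as. F (as ! j) b)) Y r s J as"
      using sh[of "2 ^ m", folded J_def] by blast
    define avg where "avg i b = (1 / real (length (as i))) * (\<Sum>j<length (as i). F (as i ! j) b)" for i b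
    \<comment> \<open>A pattern \<open>P\<close> names the high side, while
      \<open>shatters_points\<close> takes the low side; hence the complement.\<close>
    have "\<exists>b\<in>Y. (\<forall>i\<in>J - P. avg i b \<le> r) \<and> (\<forall>i\<in>P. s \<le> avg i b)" if "P \<subseteq> J" for P
    proof -
      have "J - (J - P) = P" using that by auto
      then show ?thesis
        using shat[unfolded shatters_points_def, rule_format, of "J - P"] by (simp add: avg_def)
    qed
    then obtain b where b: "\<And>P. P \<subseteq> J \<Longrightarrow> b P \<in> Y" "\<And>P i. P \<subseteq> J \<Longrightarrow> i \<in> J - P \<Longrightarrow> avg i (b P) \<le> r"
      "\<And>P i. P \<subseteq> J \<Longrightarrow> i \<in> P \<Longrightarrow> s \<le> avg i (b P)"
      by metis
    have "\<exists>x\<in>X. 2 ^ card J * ((s - r) / 2) \<le> (\<Sum>P\<in>Pow J. sgn_in P i * F x (b P))" if i: "i \<in> J" for i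
    proof -
      obtain x where "x \<in> set (as i)" "2 ^ card J * ((s - r) / 2) \<le> (\<Sum>P\<in>Pow J. sgn_in P i * F x (b P))"
        using exists_correlated_point[OF J(1) i as(1)[OF i], of F b r s] b(2,3) i
        unfolding avg_def by blast
      then show ?thesis using as(2)[OF i] by blast
    qed
    then obtain x where x: "\<And>i. i \<in> J \<Longrightarrow> x i \<in> X"
      "\<And>i. i \<in> J \<Longrightarrow> 2 ^ card J * ((s - r) / 2) \<le> (\<Sum>P\<in>Pow J. sgn_in P i * F (x i) (b P))"
      by metis
    define f where "f P i = F (x i) (b P)" for P i
    define q where "q P i = nat \<lfloor>B * f P i\<rfloor>" for P i
    have f01: "0 \<le> f P i" "f P i \<le> 1" if "P \<subseteq> J" "i \<in> J" for P i
      using F[OF x(1)[OF that(2)] b(1)[OF that(1)]] by (auto simp: f_def)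
    have q_eq: "real (q P i) = of_int \<lfloor>B * f P i\<rfloor>" if "P \<subseteq> J" "i \<in> J" for P i
      using f01[OF that] by (simp add: q_def)
    have q: "real (q P i) \<le> B * f P i" "B * f P i < real (q P i) + 1" "q P i \<le> B"
      if "P \<subseteq> J" "i \<in> J" for P i
    proof -
      show 1: "real (q P i) \<le> B * f P i" "B * f P i < real (q P i) + 1"
        unfolding q_eq[OF that] by linarith+
      have "B * f P i \<le> B" using f01[OF that] by (simp add: mult_left_le)
      then show "q P i \<le> B" using 1 by linarith
    qed
    \<comment> \<open>Separation of \<open>G\<close> serves the combinatorial lemma; its being a net
      serves the lower bound on its size.\<close>
    obtain G where G: "G \<subseteq> q ` Pow J" "separated_on J G"
      "\<And>h. h \<in> q ` Pow J \<Longrightarrow> \<exists>g\<in>G. \<forall>i\<in>J. h i < g i + 2 \<and> g i < h i + 2"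
      using exists_maximal_separated[of "q ` Pow J" J] J(1) by (metis finite_Pow_iff finite_imageI)
    have finG: "finite G" using G(1) J(1) by (auto intro: finite_subset)
    have GB: "g i \<le> B" if "g \<in> G" "i \<in> J" for g i using that G(1) q(3) by auto
    define G' where "G' = (\<lambda>g i. real (g i) / B) ` G"
    have "exp (\<delta>\<^sup>2 / 4 * card J) \<le> card G'"
    proof (rule card_net_ge[OF J(1) _ _ \<delta>(1,2), where f = f])
      show "finite G'" using finG by (simp add: G'_def)
      show "\<bar>g i\<bar> \<le> 1" if "g \<in> G'" "i \<in> J" for g i
        using that GB B by (auto simp: G'_def)
      show "2 ^ card J * (2 * \<delta>) \<le> (\<Sum>P\<in>Pow J. sgn_in P i * f P i)" if "i \<in> J" for i
      proof -
        have "2 ^ card J * (2 * \<delta>) \<le> 2 ^ card J * ((s - r) / 2)" using \<delta>(3) by (intro mult_left_mono) auto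
        also note x(2)[OF that]
        finally show ?thesis by (simp add: f_def)
      qed
      show "\<exists>g\<in>G'. \<forall>i\<in>J. \<bar>f P i - g i\<bar> \<le> \<delta>" if P: "P \<subseteq> J" for P
      proof -
        obtain g where g: "g \<in> G" "\<And>i. i \<in> J \<Longrightarrow> q P i < g i + 2" "\<And>i. i \<in> J \<Longrightarrow> g i < q P i + 2"
          using G(3)[of "q P"] P by auto
        have "\<bar>f P i - real (g i) / B\<bar> \<le> \<delta>" if i: "i \<in> J" for i
        proof -
          have "\<bar>B * f P i - real (g i)\<bar> \<le> 2"
            using q(1,2)[OF P i] g(2,3)[OF i] by linarith
          then have "\<bar>B * f P i - real (g i)\<bar> \<le> \<delta> * B" using B\<delta> by linarith
          moreover have "B * f P i - real (g i) = (f P i - real (g i) / B) * B"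
            using B by (simp add: field_simps)
          ultimately show ?thesis using B by (simp add: abs_mult)
        qed
        then show ?thesis using g(1) by (auto simp: G'_def)
      qed
    qed
    also have "real (card G') \<le> card G" using finG by (simp add: G'_def card_image_le)
    finally have "2 ^ ((m + 2 * B + 1) * ((m + B + 1) * (B * D) + 1)) \<le> real (card G)"
      using m J(2) by simp
    then have "2 ^ ((m + 2 * B + 1) * ((m + B + 1) * (B * D) + 1)) \<le> card G"
      by (metis of_nat_le_iff of_nat_numeral of_nat_power)
    moreover have "g i < 2 ^ B" if "g \<in> G" "i \<in> J" for g i
      using GB[OF that] less_exp[of B] by linarith
    ultimately obtain t where t: "dom t \<subseteq> J" "strongly_shatters G t" "B * D < card (dom t)"
      using exists_large_shattered_map[OF J finG G(2), of B "B * D"] by (metis (no_types, lifting))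
    have fin_t: "finite (dom t)" using t(1) J(1) by (rule finite_subset)
    \<comment> \<open>For \<open>E = UNIV\<close> some member of \<open>G\<close> exceeds all
      thresholds at once, and its values are at most \<open>B\<close>.\<close>
    have t_less: "w < B" if w: "t i = Some w" for i w
    proof -
      obtain g where "g \<in> G" "w < g i"
        using t(2)[unfolded strongly_shatters_def, rule_format, of UNIV] w by auto
      moreover have "i \<in> J" using t(1) w by auto
      ultimately show ?thesis using GB by fastforce
    qed
    obtain w where w: "w < B" "D \<le> card {i. t i = Some w}"
    proof -
      have "\<exists>w<B. D \<le> card {i. t i = Some w}"
      proof (rule ccontr)
        assume "\<not> ?thesis"
        then have "(\<Sum>w<B. card {i. t i = Some w}) \<le> (\<Sum>w<B. D)"
          by (intro sum_mono) force
        moreover have "dom t = (\<Union>w<B. {i. t i = Some w})" using t_less by auto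
        then have "card (dom t) \<le> (\<Sum>w<B. card {i. t i = Some w})"
          using card_UN_le[of "{..<B}" "\<lambda>w. {i. t i = Some w}"] by simp
        ultimately show False using t(3) by simp
      qed
      then show ?thesis using that by blast
    qed
    let ?S = "{i. t i = Some w}"
    have "finite ?S" by (rule finite_subset[OF _ fin_t]) auto
    then obtain h where h: "bij_betw h {..<card ?S} ?S"
      using ex_bij_betw_nat_finite[of ?S] by (auto simp: atLeast0LessThan)
    have dS: "d w \<le> card ?S" using dD[OF w(1)] w(2) by simp
    have hS: "t (h k) = Some w" if "k < d w" for k
      using h that dS by (auto simp: bij_betw_def)
    then have hJ: "h k \<in> J" if "k < d w" for k using t(1) that by blast
    have inj: "inj_on h {..<d w}"
      using h dS by (auto simp: bij_betw_def intro: inj_on_subset)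
    have "shatters_points F Y (real w / B) (real (w + 1) / B) {..<d w} (\<lambda>k. x (h k))"
      unfolding shatters_points_def
    proof (intro allI impI)
      fix I assume I: "I \<subseteq> {..<d w}"
      \<comment> \<open>\<open>E\<close> names the coordinates above the threshold, so it is the
        image of the complement of \<open>I\<close>.\<close>
      obtain g where g: "g \<in> G"
        "\<And>i. t i = Some w \<Longrightarrow> if i \<in> h ` ({..<d w} - I) then w < g i else g i < w"
        using t(2)[unfolded strongly_shatters_def, rule_format, of "h ` ({..<d w} - I)"] by blast
      obtain P where P: "P \<subseteq> J" "g = q P" using g(1) G(1) by auto
      have "F (x (h k)) (b P) \<le> real w / B" if k: "k \<in> I" for k
      proof -
        have kd: "k < d w" using k I by auto
        have "h k \<notin> h ` ({..<d w} - I)" using inj k I by (auto simp: inj_on_def)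
        \<comment> \<open>Strictness absorbs the rounding down: \<open>q P (h k) + 1\<close> is at
          most \<open>w\<close>, which bounds the true value by \<open>w / B\<close>.\<close>
        then have "q P (h k) < w" using g(2)[OF hS[OF kd]] P(2) by simp
        then have "B * f P (h k) \<le> w" using q(2)[OF P(1) hJ[OF kd]] by linarith
        then show ?thesis using B by (simp add: f_def field_simps)
      qed
      moreover have "real (w + 1) / B \<le> F (x (h k)) (b P)" if k: "k \<in> {..<d w} - I" for k
      proof -
        have kd: "k < d w" using k by auto
        have "w < q P (h k)" using g(2)[OF hS[OF kd]] P(2) k by simp
        then have "real (w + 1) \<le> B * f P (h k)" using q(1)[OF P(1) hJ[OF kd]] by linarith
        then show ?thesis using B by (simp add: f_def field_simps)
      qed
      ultimately show "\<exists>b\<in>Y. (\<forall>i\<in>I. F (x (h i)) b \<le> real w / B) \<and>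
          (\<forall>i\<in>{..<d w} - I. real (w + 1) / B \<le> F (x (h i)) b)"
        using b(1)[OF P(1)] by blast
    qed
    then have "ok w (d w)" unfolding ok_def using x(1) hJ by (intro exI[of _ "\<lambda>k. x (h k)"]) simp
    then show False using d[OF w(1)] by blast
  qed
  then obtain w where w: "w < B" "\<And>d. ok w d" by blast
  moreover have "0 \<le> real w / B" "real w / B < real (w + 1) / B" "real (w + 1) / B \<le> 1"
    using w(1) by (auto simp: field_simps)
  ultimately show ?thesis
    unfolding ok_def by (intro exI[of _ "real w / B"] exI[of _ "real (w + 1) / B"]) simp
qed

section \<open>Values of formulas\<close>

definition is_asg :: "('f, 'p, 'a) mstructure \<Rightarrow> (nat \<Rightarrow> 'a) \<Rightarrow> bool" where
  "is_asg M e \<longleftrightarrow> (\<forall>v. e v \<in> univ M)"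

lemma is_asg_upd: "is_asg M e \<Longrightarrow> c \<in> univ M \<Longrightarrow> is_asg M (e(v := c))"
  by (simp add: is_asg_def)

lemma tm_val_cong: "(\<And>v. v \<in> tm_vars t \<Longrightarrow> e v = e' v) \<Longrightarrow> tm_val M t e = tm_val M t e'"
proof (induction t)
  case (Fun f ts)
  have "map (\<lambda>t. tm_val M t e) ts = map (\<lambda>t. tm_val M t e') ts"
    using Fun by (intro map_cong refl Fun.IH) auto
  then show ?case by (simp only: tm_val.simps)
qed simp

lemma fm_val_cong:
  "(\<And>v. v \<in> free_vars \<phi> \<Longrightarrow> e v = e' v) \<Longrightarrow> fm_val M \<phi> e = fm_val M \<phi> e'"
proof (induction \<phi> arbitrary: e e')
  case (Dist t t')
  then show ?case using tm_val_cong[of t e e' M] tm_val_cong[of t' e e' M] by simp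
next
  case (Pred P ts)
  have "map (\<lambda>t. tm_val M t e) ts = map (\<lambda>t. tm_val M t e') ts"
    using Pred by (intro map_cong refl tm_val_cong) auto
  then show ?case by (simp only: fm_val.simps)
next
  case (Conn u \<phi>s)
  have "map (\<lambda>\<phi>. fm_val M \<phi> e) \<phi>s = map (\<lambda>\<phi>. fm_val M \<phi> e') \<phi>s"
    by (intro map_cong refl Conn.IH) (use Conn.prems in auto)
  then show ?case by (simp only: fm_val.simps)
next
  case (Sup_fm v \<phi>)
  have "fm_val M \<phi> (e(v := c)) = fm_val M \<phi> (e'(v := c))" for c
    using Sup_fm by (intro Sup_fm.IH) auto
  then show ?case by simp
next
  case (Inf_fm v \<phi>)
  have "fm_val M \<phi> (e(v := c)) = fm_val M \<phi> (e'(v := c))" for c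
    using Inf_fm by (intro Inf_fm.IH) auto
  then show ?case by simp
qed

lemma finite_tm_vars: "finite (tm_vars t)"
  by (induction t) auto

lemma finite_free_vars: "finite (free_vars \<phi>)"
  by (induction \<phi>) (auto simp: finite_tm_vars)

lemma tm_val_in_univ:
  assumes "is_structure L M" "is_asg M e" "t \<in> terms L"
  shows "tm_val M t e \<in> univ M"
  using assms(3)
proof induction
  case (1 v)
  then show ?case using assms(2) by (simp add: is_asg_def)
next
  case (2 f ts)
  then have "map (\<lambda>t. tm_val M t e) ts \<in> tuples (univ M) (fun_arity L f)"
    by (auto simp: tuples_def)
  then show ?case using assms(1) 2(1) by (simp add: is_structure_def)
qed

lemma fm_val_in_unit:
  assumes "is_structure L M" "is_asg M e" "\<phi> \<in> formulas L"
  shows "fm_val M \<phi> e \<in> {0..1}"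
  using assms(3,2)
proof (induction arbitrary: e)
  case (1 t t')
  interpret Metric_space "univ M" "metric M" using assms(1) by (simp add: is_structure_def)
  show ?case
    using 1 assms(1) tm_val_in_univ[OF assms(1)] by (simp add: is_structure_def)
next
  case (2 P ts)
  then have "map (\<lambda>t. tm_val M t e) ts \<in> tuples (univ M) (pred_arity L P)"
    using tm_val_in_univ[OF assms(1)] by (auto simp: tuples_def)
  then show ?case using assms(1) 2(1) by (simp add: is_structure_def)
next
  case (3 \<phi>s u)
  have "restrict (\<lambda>i. map (\<lambda>\<phi>. fm_val M \<phi> e) \<phi>s ! i) {..<length \<phi>s} \<in> cube (length \<phi>s)"
    unfolding cube_def using 3 by (intro restrict_PiE_iff[THEN iffD2]) auto
  then show ?case using 3(1) by (auto simp: is_connective_def)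
next
  case (4 \<phi> v)
  have ne: "univ M \<noteq> {}" using assms(1) by (simp add: is_structure_def)
  then obtain c where c: "c \<in> univ M" by blast
  have val: "fm_val M \<phi> (e(v := c)) \<in> {0..1}" if "c \<in> univ M" for c
    using 4 that by (intro 4(2) is_asg_upd) auto
  have "fm_val M \<phi> (e(v := c)) \<le> (SUP c\<in>univ M. fm_val M \<phi> (e(v := c)))"
    using c val by (intro cSUP_upper bdd_aboveI2[of _ _ 1]) auto
  moreover have "(SUP c\<in>univ M. fm_val M \<phi> (e(v := c))) \<le> 1"
    using ne val by (intro cSUP_least) auto
  ultimately show ?case using val[OF c] by simp
next
  case (5 \<phi> v)
  have ne: "univ M \<noteq> {}" using assms(1) by (simp add: is_structure_def)
  then obtain c where c: "c \<in> univ M" by blast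
  have val: "fm_val M \<phi> (e(v := c)) \<in> {0..1}" if "c \<in> univ M" for c
    using 5 that by (intro 5(2) is_asg_upd) auto
  have "(INF c\<in>univ M. fm_val M \<phi> (e(v := c))) \<le> fm_val M \<phi> (e(v := c))"
    using c val by (intro cINF_lower bdd_belowI2[of _ 0]) auto
  moreover have "0 \<le> (INF c\<in>univ M. fm_val M \<phi> (e(v := c)))"
    using ne val by (intro cINF_greatest) auto
  ultimately show ?case using val[OF c] by simp
qed

section \<open>Renaming of variables\<close>

primrec ren_tm :: "(nat \<Rightarrow> nat) \<Rightarrow> 'f tm \<Rightarrow> 'f tm" where
  "ren_tm \<pi> (Var v) = Var (\<pi> v)"
| "ren_tm \<pi> (Fun f ts) = Fun f (map (ren_tm \<pi>) ts)"

text \<open>Bound variables are renamed too; for injective \<open>\<pi>\<close> there is then no capture.\<close>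

primrec ren_fm :: "(nat \<Rightarrow> nat) \<Rightarrow> ('f, 'p) fm \<Rightarrow> ('f, 'p) fm" where
  "ren_fm \<pi> (Dist t t') = Dist (ren_tm \<pi> t) (ren_tm \<pi> t')"
| "ren_fm \<pi> (Pred P ts) = Pred P (map (ren_tm \<pi>) ts)"
| "ren_fm \<pi> (Conn u \<phi>s) = Conn u (map (ren_fm \<pi>) \<phi>s)"
| "ren_fm \<pi> (Sup_fm v \<phi>) = Sup_fm (\<pi> v) (ren_fm \<pi> \<phi>)"
| "ren_fm \<pi> (Inf_fm v \<phi>) = Inf_fm (\<pi> v) (ren_fm \<pi> \<phi>)"

lemma tm_val_ren: "tm_val M (ren_tm \<pi> t) e = tm_val M t (e \<circ> \<pi>)"
proof (induction t)
  case (Fun f ts)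
  then have "map (\<lambda>t. tm_val M t e) (map (ren_tm \<pi>) ts) = map (\<lambda>t. tm_val M t (e \<circ> \<pi>)) ts"
    by (simp add: o_def)
  then show ?case by (simp only: ren_tm.simps tm_val.simps)
qed simp

lemma ren_tm_in_terms: "t \<in> terms L \<Longrightarrow> ren_tm \<pi> t \<in> terms L"
  by (induction rule: terms.induct) (auto intro!: terms.intros)

lemma ren_fm_in_formulas: "\<phi> \<in> formulas L \<Longrightarrow> ren_fm \<pi> \<phi> \<in> formulas L"
  by (induction rule: formulas.induct) (auto intro!: formulas.intros ren_tm_in_terms)

lemma fm_val_ren:
  assumes "inj \<pi>"
  shows "fm_val M (ren_fm \<pi> \<phi>) e = fm_val M \<phi> (e \<circ> \<pi>)"
proof (induction \<phi> arbitrary: e)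
  case (Conn u \<phi>s)
  have "map (\<lambda>\<phi>. fm_val M \<phi> e) (map (ren_fm \<pi>) \<phi>s) = map (\<lambda>\<phi>. fm_val M \<phi> (e \<circ> \<pi>)) \<phi>s"
    using Conn by (simp add: o_def)
  then show ?case by (simp only: ren_fm.simps fm_val.simps length_map)
next
  case (Sup_fm v \<phi>)
  have "e(\<pi> v := c) \<circ> \<pi> = (e \<circ> \<pi>)(v := c)" for c
    using assms by (auto simp: fun_eq_iff inj_eq)
  then show ?case by (simp only: ren_fm.simps fm_val.simps Sup_fm)
next
  case (Inf_fm v \<phi>)
  have "e(\<pi> v := c) \<circ> \<pi> = (e \<circ> \<pi>)(v := c)" for c
    using assms by (auto simp: fun_eq_iff inj_eq)
  then show ?case by (simp only: ren_fm.simps fm_val.simps Inf_fm)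
qed (simp_all add: tm_val_ren o_def)

section \<open>Conditions coded as zero sets of formulas\<close>

section \<open>Connectives\<close>

text \<open>Truncated subtraction expresses an upper bound \<open>r\<close> as a condition with
  value 0, the form that theories and types use. The next definition does the same for a lower
  bound.\<close>

definition exceeds_fm :: "real \<Rightarrow> ('f, 'p) fm \<Rightarrow> ('f, 'p) fm" where
  "exceeds_fm r \<phi> = Conn (\<lambda>h. max 0 (h 0 - r)) [\<phi>]"

definition lacks_fm :: "real \<Rightarrow> ('f, 'p) fm \<Rightarrow> ('f, 'p) fm" where
  "lacks_fm s \<phi> = Conn (\<lambda>h. max 0 (s - h 0)) [\<phi>]"

text \<open>Conjunction of conditions: a truncated sum of nonnegative values vanishes exactly when
  all of them do.\<close>

definition conj_fm :: "('f, 'p) fm list \<Rightarrow> ('f, 'p) fm" where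
  "conj_fm \<phi>s = Conn (\<lambda>h. min 1 (\<Sum>i<length \<phi>s. h i)) \<phi>s"

definition infs_fm :: "nat list \<Rightarrow> ('f, 'p) fm \<Rightarrow> ('f, 'p) fm" where
  "infs_fm vs \<phi> = foldr Inf_fm vs \<phi>"

lemma continuous_on_coordinate: "continuous_on S (\<lambda>h :: nat \<Rightarrow> real. h i)"
  by (rule continuous_on_subset[OF continuous_on_product_coordinates subset_UNIV])

lemma cube_bounds: "h \<in> cube n \<Longrightarrow> i < n \<Longrightarrow> 0 \<le> h i \<and> h i \<le> 1"
  unfolding cube_def by (drule PiE_mem[where x = i]) auto

lemma exceeds_fm_in_formulas:
  assumes "0 \<le> r" "\<phi> \<in> formulas L"
  shows "exceeds_fm r \<phi> \<in> formulas L"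
proof -
  have "continuous_on (cube 1) (\<lambda>h. max 0 (h 0 - r))"
    by (intro continuous_on_max continuous_on_diff continuous_on_const continuous_on_coordinate)
  moreover have "h 0 - r \<le> 1" if "h \<in> cube 1" for h
    using cube_bounds[OF that, of 0] assms(1) by simp
  ultimately have "is_connective (length [\<phi>]) (\<lambda>h. max 0 (h 0 - r))"
    by (auto simp: is_connective_def)
  then show ?thesis using assms(2) unfolding exceeds_fm_def by (intro formulas.intros) auto
qed

lemma lacks_fm_in_formulas:
  assumes "s \<le> 1" "\<phi> \<in> formulas L"
  shows "lacks_fm s \<phi> \<in> formulas L"
proof -
  have "continuous_on (cube 1) (\<lambda>h. max 0 (s - h 0))"
    by (intro continuous_on_max continuous_on_diff continuous_on_const continuous_on_coordinate)
  moreover have "s - h 0 \<le> 1" if "h \<in> cube 1" for h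
    using cube_bounds[OF that, of 0] assms(1) by simp
  ultimately have "is_connective (length [\<phi>]) (\<lambda>h. max 0 (s - h 0))"
    by (auto simp: is_connective_def)
  then show ?thesis using assms(2) unfolding lacks_fm_def by (intro formulas.intros) auto
qed

lemma conj_fm_in_formulas:
  assumes "set \<phi>s \<subseteq> formulas L"
  shows "conj_fm \<phi>s \<in> formulas L"
proof -
  let ?n = "length \<phi>s"
  have "continuous_on (cube ?n) (\<lambda>h. min 1 (\<Sum>i<?n. h i))"
    by (intro continuous_on_min continuous_on_const continuous_on_sum continuous_on_coordinate)
  moreover have "0 \<le> (\<Sum>i<?n. h i)" if "h \<in> cube ?n" for h
    using cube_bounds[OF that] by (intro sum_nonneg) auto
  ultimately have "is_connective ?n (\<lambda>h. min 1 (\<Sum>i<?n. h i))"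
    by (auto simp: is_connective_def)
  then show ?thesis using assms unfolding conj_fm_def by (intro formulas.intros) auto
qed

lemma infs_fm_in_formulas: "\<phi> \<in> formulas L \<Longrightarrow> infs_fm vs \<phi> \<in> formulas L"
  unfolding infs_fm_def by (induction vs) (simp_all add: formulas.intros(5))

lemma free_vars_infs_fm: "free_vars (infs_fm vs \<phi>) = free_vars \<phi> - set vs"
  unfolding infs_fm_def by (induction vs) auto

lemma fm_val_exceeds: "fm_val M (exceeds_fm r \<phi>) e = max 0 (fm_val M \<phi> e - r)"
  by (simp add: exceeds_fm_def)

lemma fm_val_lacks: "fm_val M (lacks_fm s \<phi>) e = max 0 (s - fm_val M \<phi> e)"
  by (simp add: lacks_fm_def)

lemma fm_val_conj: "fm_val M (conj_fm \<phi>s) e = min 1 (\<Sum>i<length \<phi>s. fm_val M (\<phi>s ! i) e)"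
  by (simp add: conj_fm_def)

lemma fm_val_conj_eq_0:
  assumes "is_structure L M" "is_asg M e" "set \<phi>s \<subseteq> formulas L"
  shows "fm_val M (conj_fm \<phi>s) e = 0 \<longleftrightarrow> (\<forall>\<phi>\<in>set \<phi>s. fm_val M \<phi> e = 0)"
proof -
  have "0 \<le> fm_val M (\<phi>s ! i) e" if "i < length \<phi>s" for i
    using fm_val_in_unit[OF assms(1,2), of "\<phi>s ! i"] that assms(3) by (auto simp: subset_iff)
  then have "(\<Sum>i<length \<phi>s. fm_val M (\<phi>s ! i) e) = 0 \<longleftrightarrow> (\<forall>i<length \<phi>s. fm_val M (\<phi>s ! i) e = 0)"
    by (subst sum_nonneg_eq_0_iff) auto
  then show ?thesis by (auto simp: fm_val_conj min_def all_set_conv_all_nth)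
qed

text \<open>A strict inequality passes through nested infima to a witness; equality with 0 does not,
  as an infimum need not be attained in a general structure.\<close>

lemma fm_val_infs_less_iff:
  assumes "is_structure L M" "is_asg M e" "\<phi> \<in> formulas L"
  shows "fm_val M (infs_fm vs \<phi>) e < \<epsilon> \<longleftrightarrow>
    (\<exists>e'. is_asg M e' \<and> (\<forall>v. v \<notin> set vs \<longrightarrow> e' v = e v) \<and> fm_val M \<phi> e' < \<epsilon>)"
  using assms(2)
proof (induction vs arbitrary: e)
  case Nil
  have "e' = e" if "\<forall>v. v \<notin> set [] \<longrightarrow> e' v = e v" for e' using that by auto
  then show ?case using Nil by (auto simp: infs_fm_def)
next
  case (Cons w vs)
  let ?\<psi> = "infs_fm vs \<phi>"
  have ne: "univ M \<noteq> {}" using assms(1) by (simp add: is_structure_def)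
  have "0 \<le> fm_val M ?\<psi> (e(w := c))" if "c \<in> univ M" for c
    using fm_val_in_unit[OF assms(1) is_asg_upd[OF Cons.prems that] infs_fm_in_formulas[OF assms(3)]]
    by auto
  then have "bdd_below ((\<lambda>c. fm_val M ?\<psi> (e(w := c))) ` univ M)" by (intro bdd_belowI2[of _ 0])
  then have "fm_val M (infs_fm (w # vs) \<phi>) e < \<epsilon> \<longleftrightarrow> (\<exists>c\<in>univ M. fm_val M ?\<psi> (e(w := c)) < \<epsilon>)"
    using ne by (simp add: infs_fm_def cINF_less_iff)
  also have "\<dots> \<longleftrightarrow> (\<exists>c\<in>univ M. \<exists>e'. is_asg M e' \<and> (\<forall>v. v \<notin> set vs \<longrightarrow> e' v = (e(w := c)) v) \<and> fm_val M \<phi> e' < \<epsilon>)"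
    using Cons.IH[OF is_asg_upd[OF Cons.prems]] by (intro bex_cong refl) blast
  also have "\<dots> \<longleftrightarrow> (\<exists>e'. is_asg M e' \<and> (\<forall>v. v \<notin> set (w # vs) \<longrightarrow> e' v = e v) \<and> fm_val M \<phi> e' < \<epsilon>)"
    (is "?l \<longleftrightarrow> ?r")
  proof
    assume ?l then show ?r by (auto simp: fun_upd_def split: if_splits)
  next
    assume ?r
    then obtain e' where e': "is_asg M e'" "\<And>v. v \<notin> set (w # vs) \<Longrightarrow> e' v = e v" "fm_val M \<phi> e' < \<epsilon>"
      by blast
    then show ?l
      by (intro bexI[of _ "e' w"] exI[of _ e']) (auto simp: is_asg_def)
  qed
  finally show ?case .
qed

text \<open>The direction valid in every structure; \<open>infs_attained\<close> is the converse
  under saturation. Since \<open>e'\<close> may differ from \<open>e\<close> at variables that do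
  not matter, the witness is spliced from both.\<close>

lemma fm_val_infs_eq_0I:
  assumes "is_structure L M" "is_asg M e" "\<phi> \<in> formulas L"
    and "is_asg M e'" "\<And>v. v \<in> free_vars \<phi> \<Longrightarrow> v \<notin> set vs \<Longrightarrow> e' v = e v" "fm_val M \<phi> e' = 0"
  shows "fm_val M (infs_fm vs \<phi>) e = 0"
proof -
  define e'' where "e'' v = (if v \<in> set vs then e' v else e v)" for v
  have e'': "is_asg M e''" using assms(2,4) by (simp add: is_asg_def e''_def)
  have "fm_val M \<phi> e'' = 0" using assms(5,6) fm_val_cong[of \<phi> e'' e' M] by (auto simp: e''_def)
  then have "fm_val M (infs_fm vs \<phi>) e < \<epsilon>" if "0 < \<epsilon>" for \<epsilon>
    using that e'' by (subst fm_val_infs_less_iff[OF assms(1-3)]) (auto simp: e''_def intro!: exI[of _ e''])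
  moreover have "0 \<le> fm_val M (infs_fm vs \<phi>) e"
    using fm_val_in_unit[OF assms(1,2) infs_fm_in_formulas[OF assms(3)]] by auto
  ultimately show ?thesis by (metis less_irrefl order_le_less)
qed

section \<open>Realising types by assignments, first for finitely many and then for countably many
  variables\<close>

section \<open>Saturation for assignments\<close>

lemma asg_map: "v \<in> set xs \<Longrightarrow> asg xs (map g xs) v = g v"
proof -
  have "map_of (zip xs (map g xs)) v = Some (g v)" if "v \<in> set xs"
    using that by (induction xs) auto
  then show "v \<in> set xs \<Longrightarrow> asg xs (map g xs) v = g v" by (simp add: asg_def)
qed

lemma map_asg: "distinct xs \<Longrightarrow> length a = length xs \<Longrightarrow> map (asg xs a) xs = a"
  by (rule nth_equalityI) (auto simp: asg_def map_of_zip_nth)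

text \<open>Translates the tuples of \<open>saturated\<close> and \<open>has_IP\<close> into
  assignments, in which the arguments below are phrased.\<close>

lemma inst_val_map:
  assumes "partitioned L \<phi> xs ys"
    and "\<And>v. v \<in> set xs \<Longrightarrow> e v = g v" "\<And>v. v \<in> set ys \<Longrightarrow> e v = h v"
  shows "inst_val M xs (map g xs) (\<phi>, ys, map h ys) = fm_val M \<phi> e"
proof -
  have "map g xs @ map h ys = map e (xs @ ys)" using assms(2,3) by auto
  then have "inst_val M xs (map g xs) (\<phi>, ys, map h ys) = fm_val M \<phi> (asg (xs @ ys) (map e (xs @ ys)))"
    by (simp only: inst_val_def prod.case)
  also have "\<dots> = fm_val M \<phi> e"
    using assms(1) by (intro fm_val_cong asg_map) (auto simp: partitioned_def)
  finally show ?thesis .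
qed

text \<open>All parameters are values of \<open>e\<close>, which form a countable set and hence one
  smaller than \<open>\<kappa>\<close>.\<close>

lemma saturated_asg:
  fixes U :: "('f, 'p, 'u) mstructure"
  assumes "saturated L \<kappa> U" "natLeq <o \<kappa>"
    and "is_asg U e" "\<Gamma> \<subseteq> formulas L"
    and fin: "\<And>\<Gamma>\<^sub>0. finite \<Gamma>\<^sub>0 \<Longrightarrow> \<Gamma>\<^sub>0 \<subseteq> \<Gamma> \<Longrightarrow>
      \<exists>e'. is_asg U e' \<and> (\<forall>v. v \<notin> set vs \<longrightarrow> e' v = e v) \<and> (\<forall>\<phi>\<in>\<Gamma>\<^sub>0. fm_val U \<phi> e' = 0)"
  shows "\<exists>e'. is_asg U e' \<and> (\<forall>v. v \<notin> set vs \<longrightarrow> e' v = e v) \<and> (\<forall>\<phi>\<in>\<Gamma>. fm_val U \<phi> e' = 0)"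
proof -
  define xs where "xs = remdups vs"
  \<comment> \<open>Each formula receives its own parameter tuple, indexed by its free variables
    outside \<open>vs\<close>.\<close>
  define ys where "ys \<phi> = sorted_list_of_set (free_vars \<phi> - set vs)" for \<phi> :: "('f, 'p) fm"
  define inst where "inst \<phi> = (\<phi>, ys \<phi>, map e (ys \<phi>))" for \<phi> :: "('f, 'p) fm"
  have xs: "distinct xs" "set xs = set vs" by (auto simp: xs_def)
  have ys: "distinct (ys \<phi>)" "set (ys \<phi>) = free_vars \<phi> - set vs" for \<phi>
    by (auto simp: ys_def finite_free_vars)
  have part: "partitioned L \<phi> xs (ys \<phi>)" if "\<phi> \<in> \<Gamma>" for \<phi>
    using that assms(4) xs ys by (auto simp: partitioned_def)
  have val: "inst_val U xs (map e' xs) (inst \<phi>) = fm_val U \<phi> e'"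
    if "\<phi> \<in> \<Gamma>" "\<forall>v. v \<notin> set vs \<longrightarrow> e' v = e v" for \<phi> e'
    unfolding inst_def using that(2) ys by (intro inst_val_map[OF part[OF that(1)]]) auto
  have "|range e| \<le>o natLeq"
    using card_of_image[of e "UNIV :: nat set"] card_of_nat ordLeq_ordIso_trans by blast
  then have "|range e| <o \<kappa>" using assms(2) ordLeq_ordLess_trans by blast
  moreover have "range e \<subseteq> univ U" using assms(3) by (auto simp: is_asg_def)
  moreover have "inst ` \<Gamma> \<subseteq> insts L (range e) xs"
    using part by (auto simp: insts_def inst_def tuples_def)
  moreover have "\<exists>a\<in>tuples (univ U) (length xs). \<forall>p\<in>\<Delta>. inst_val U xs a p = 0"
    if \<Delta>: "finite \<Delta>" "\<Delta> \<subseteq> inst ` \<Gamma>" for \<Delta>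
  proof -
    obtain \<Gamma>\<^sub>0 where \<Gamma>\<^sub>0: "finite \<Gamma>\<^sub>0" "\<Gamma>\<^sub>0 \<subseteq> \<Gamma>" "\<Delta> = inst ` \<Gamma>\<^sub>0"
      using finite_subset_image[OF \<Delta>] by blast
    then obtain e' where e': "is_asg U e'" "\<forall>v. v \<notin> set vs \<longrightarrow> e' v = e v" "\<forall>\<phi>\<in>\<Gamma>\<^sub>0. fm_val U \<phi> e' = 0"
      using fin[of \<Gamma>\<^sub>0] by blast
    then have "\<forall>p\<in>\<Delta>. inst_val U xs (map e' xs) p = 0"
      using \<Gamma>\<^sub>0 val[OF _ e'(2)] by auto
    moreover have "map e' xs \<in> tuples (univ U) (length xs)"
      using e'(1) by (auto simp: tuples_def is_asg_def)
    ultimately show ?thesis by blast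
  qed
  ultimately obtain a where a: "a \<in> tuples (univ U) (length xs)" "\<forall>p\<in>inst ` \<Gamma>. inst_val U xs a p = 0"
    using assms(1)[unfolded saturated_def, rule_format, of "range e" xs "inst ` \<Gamma>"] xs(1) by blast
  define e' where "e' v = (if v \<in> set vs then asg xs a v else e v)" for v
  have "map e' xs = map (asg xs a) xs" using xs(2) by (auto simp: e'_def)
  also have "\<dots> = a" using a(1) xs(1) by (intro map_asg) (auto simp: tuples_def)
  finally have a_eq: "map e' xs = a" .
  have off: "\<forall>v. v \<notin> set vs \<longrightarrow> e' v = e v" by (simp add: e'_def)
  have "e' v \<in> univ U" for v
  proof (cases "v \<in> set vs")
    case True
    then have "e' v \<in> set (map e' xs)" using xs(2) by auto
    then show ?thesis using a(1) a_eq by (auto simp: tuples_def)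
  next
    case False
    then show ?thesis using assms(3) by (simp add: e'_def is_asg_def)
  qed
  then have "is_asg U e'" by (simp add: is_asg_def)
  moreover have "\<forall>\<phi>\<in>\<Gamma>. fm_val U \<phi> e' = 0" using a(2) a_eq val[OF _ off] by auto
  ultimately show ?thesis using off by blast
qed

text \<open>An infimum 0 makes the conditions \<open>\<phi> \<le> \<epsilon>\<close> finitely
  satisfiable; saturation realises all of them at once, which forces the value 0.\<close>

lemma infs_attained:
  assumes "saturated L \<kappa> U" "natLeq <o \<kappa>" "is_structure L U"
    and "is_asg U e" "\<phi> \<in> formulas L" "fm_val U (infs_fm vs \<phi>) e = 0"
  shows "\<exists>e'. is_asg U e' \<and> (\<forall>v. v \<notin> set vs \<longrightarrow> e' v = e v) \<and> fm_val U \<phi> e' = 0"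
proof -
  let ?\<Gamma> = "(\<lambda>\<epsilon>. exceeds_fm \<epsilon> \<phi>) ` {0<..}"
  have "\<exists>e'. is_asg U e' \<and> (\<forall>v. v \<notin> set vs \<longrightarrow> e' v = e v) \<and> (\<forall>\<psi>\<in>?\<Gamma>. fm_val U \<psi> e' = 0)"
  proof (rule saturated_asg[OF assms(1,2,4)])
    show "?\<Gamma> \<subseteq> formulas L" using assms(5) by (auto intro: exceeds_fm_in_formulas)
    fix \<Gamma>\<^sub>0 assume "finite \<Gamma>\<^sub>0" "\<Gamma>\<^sub>0 \<subseteq> ?\<Gamma>"
    then obtain E where E: "finite E" "E \<subseteq> {0<..}" "\<Gamma>\<^sub>0 = (\<lambda>\<epsilon>. exceeds_fm \<epsilon> \<phi>) ` E"
      using finite_subset_image by metis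
    \<comment> \<open>Inserting 1 covers the case of an empty \<open>E\<close>.\<close>
    have "0 < Min (insert 1 E)" using E by auto
    then obtain e' where e': "is_asg U e'" "\<forall>v. v \<notin> set vs \<longrightarrow> e' v = e v" "fm_val U \<phi> e' < Min (insert 1 E)"
      using fm_val_infs_less_iff[OF assms(3,4,5), of vs "Min (insert 1 E)"] assms(6) by auto
    have "fm_val U \<phi> e' \<le> \<epsilon>" if "\<epsilon> \<in> E" for \<epsilon>
      using e'(3) E(1) that by (meson Min_le finite_insert insertI2 less_le_not_le order_trans)
    then show "\<exists>e'. is_asg U e' \<and> (\<forall>v. v \<notin> set vs \<longrightarrow> e' v = e v) \<and> (\<forall>\<psi>\<in>\<Gamma>\<^sub>0. fm_val U \<psi> e' = 0)"
      using e'(1,2) E(3) by (intro exI[of _ e']) (auto simp: fm_val_exceeds)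
  qed
  then obtain e' where e': "is_asg U e'" "\<forall>v. v \<notin> set vs \<longrightarrow> e' v = e v"
    "\<And>\<epsilon>. 0 < \<epsilon> \<Longrightarrow> fm_val U (exceeds_fm \<epsilon> \<phi>) e' = 0"
    by auto
  have "fm_val U \<phi> e' \<le> 0"
  proof (rule field_le_epsilon)
    fix \<epsilon> :: real assume "0 < \<epsilon>"
    then show "fm_val U \<phi> e' \<le> 0 + \<epsilon>" using e'(3)[of \<epsilon>] by (simp add: fm_val_exceeds max_def split: if_splits)
  qed
  then have "fm_val U \<phi> e' = 0" using fm_val_in_unit[OF assms(3) e'(1) assms(5)] by auto
  then show ?thesis using e'(1,2) by blast
qed

text \<open>
  Saturation only realises types in finitely many variables, so the assignment is built one
  variable at a time; the later variables are quantified away.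
\<close>

lemma saturated_asg_sequence:
  assumes "saturated L \<kappa> U" "natLeq <o \<kappa>" "is_structure L U"
    and \<theta>: "\<And>d. \<theta> d \<in> formulas L"
    and mono: "\<And>d d' e. d \<le> d' \<Longrightarrow> is_asg U e \<Longrightarrow> fm_val U (\<theta> d') e = 0 \<Longrightarrow> fm_val U (\<theta> d) e = 0"
    and sat: "\<And>d :: nat. \<exists>e. is_asg U e \<and> fm_val U (\<theta> d) e = 0"
  shows "\<exists>e. is_asg U e \<and> (\<forall>d. fm_val U (\<theta> d) e = 0)"
proof -
  \<comment> \<open>Invariant: the first \<open>n\<close> values of \<open>e\<close> extend to a
    solution of each \<open>\<theta> d\<close> separately.\<close>
  define Q where "Q n e \<longleftrightarrow> is_asg U e \<and>
    (\<forall>d. \<exists>e'. is_asg U e' \<and> (\<forall>v<n. e' v = e v) \<and> fm_val U (\<theta> d) e' = 0)" for n e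
  have "\<exists>e. \<forall>n. Q n (e n) \<and> (\<forall>v<n. e (Suc n) v = e n v)"
  proof (rule dependent_nat_choice)
    show "\<exists>e. Q 0 e" using sat by (auto simp: Q_def)
    fix e n assume Q: "Q n e"
    \<comment> \<open>Variables above \<open>n\<close> are quantified away and those below
      \<open>n\<close> are parameters, so only the value at \<open>n\<close> is sought.\<close>
    define vs where "vs d = sorted_list_of_set (free_vars (\<theta> d) - {..n})" for d
    have vs: "set (vs d) = free_vars (\<theta> d) - {..n}" for d by (simp add: vs_def finite_free_vars)
    let ?\<Gamma> = "range (\<lambda>d. infs_fm (vs d) (\<theta> d))"
    have e: "is_asg U e" using Q by (simp add: Q_def)
    have "\<exists>e'. is_asg U e' \<and> (\<forall>v. v \<notin> set [n] \<longrightarrow> e' v = e v) \<and> (\<forall>\<psi>\<in>?\<Gamma>. fm_val U \<psi> e' = 0)"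
    proof (rule saturated_asg[OF assms(1,2) e])
      show "?\<Gamma> \<subseteq> formulas L" using \<theta> by (auto intro: infs_fm_in_formulas)
      fix \<Gamma>\<^sub>0 assume "finite \<Gamma>\<^sub>0" "\<Gamma>\<^sub>0 \<subseteq> ?\<Gamma>"
      then obtain C where C: "finite C" "\<Gamma>\<^sub>0 = (\<lambda>d. infs_fm (vs d) (\<theta> d)) ` C"
        using finite_subset_image by metis
      \<comment> \<open>By monotonicity a solution for the upper bound \<open>D\<close> serves all
        indices in \<open>C\<close>.\<close>
      obtain D where D: "\<And>d. d \<in> C \<Longrightarrow> d \<le> D"
        using C(1) by (meson finite_nat_set_iff_bounded_le)
      obtain e' where e': "is_asg U e'" "\<And>v. v < n \<Longrightarrow> e' v = e v" "fm_val U (\<theta> D) e' = 0"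
        using Q unfolding Q_def by blast
      have asg: "is_asg U (e(n := e' n))" using e e'(1) by (simp add: is_asg_def)
      have "fm_val U (infs_fm (vs d) (\<theta> d)) (e(n := e' n)) = 0" if "d \<in> C" for d
        using e'(2) vs mono[OF D[OF that] e'(1,3)]
        by (intro fm_val_infs_eq_0I[OF assms(3) asg \<theta> e'(1)]) auto
      then show "\<exists>e'. is_asg U e' \<and> (\<forall>v. v \<notin> set [n] \<longrightarrow> e' v = e v) \<and> (\<forall>\<psi>\<in>\<Gamma>\<^sub>0. fm_val U \<psi> e' = 0)"
        using asg C(2) by (intro exI[of _ "e(n := e' n)"]) auto
    qed
    then obtain e2 where e2: "is_asg U e2" "\<And>v. v \<noteq> n \<Longrightarrow> e2 v = e v"
      "\<And>d. fm_val U (infs_fm (vs d) (\<theta> d)) e2 = 0"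
      by auto
    have "\<exists>e'. is_asg U e' \<and> (\<forall>v<Suc n. e' v = e2 v) \<and> fm_val U (\<theta> d) e' = 0" for d
    proof -
      obtain e' where e': "is_asg U e'" "\<forall>v. v \<notin> set (vs d) \<longrightarrow> e' v = e2 v" "fm_val U (\<theta> d) e' = 0"
        using infs_attained[OF assms(1-3) e2(1) \<theta> e2(3)] by blast
      moreover have "v \<notin> set (vs d)" if "v < Suc n" for v using that vs by auto
      ultimately show ?thesis by blast
    qed
    then have "Q (Suc n) e2" using e2(1) by (simp add: Q_def)
    then show "\<exists>e'. Q (Suc n) e' \<and> (\<forall>v<n. e' v = e v)" using e2(2) by auto
  qed
  then obtain e where e: "\<And>n. Q n (e n)" "\<And>n v. v < n \<Longrightarrow> e (Suc n) v = e n v" by blast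
  \<comment> \<open>Stage \<open>Suc v\<close> fixes the value at \<open>v\<close> for good.\<close>
  define e\<^sub>\<omega> where "e\<^sub>\<omega> v = e (Suc v) v" for v
  have stable: "e n v = e\<^sub>\<omega> v" if "v < n" for n v
    using that
  proof (induction n)
    case (Suc n)
    then show ?case using e(2)[of v n] by (cases "v = n") (auto simp: e\<^sub>\<omega>_def)
  qed simp
  have "is_asg U e\<^sub>\<omega>" using e(1) by (auto simp: Q_def is_asg_def e\<^sub>\<omega>_def)
  moreover have "fm_val U (\<theta> d) e\<^sub>\<omega> = 0" for d
  proof -
    \<comment> \<open>\<open>\<theta> d\<close> has finitely many free variables, so a finite stage
      decides its value.\<close>
    obtain n where n: "\<And>v. v \<in> free_vars (\<theta> d) \<Longrightarrow> v < n"
      using finite_free_vars[of "\<theta> d"] by (meson finite_nat_set_iff_bounded)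
    obtain e' where e': "\<And>v. v < n \<Longrightarrow> e' v = e n v" "fm_val U (\<theta> d) e' = 0"
      using e(1)[of n] unfolding Q_def by blast
    have "fm_val U (\<theta> d) e\<^sub>\<omega> = fm_val U (\<theta> d) e'"
      using n e'(1) stable by (intro fm_val_cong) auto
    then show ?thesis using e'(2) by simp
  qed
  ultimately show ?thesis by blast
qed

section \<open>Elementary equivalence\<close>

text \<open>A theory records only the sentences of value 0. The value \<open>c\<close> of
  \<open>\<sigma>\<close> in the structure defining \<open>T\<close> is captured by two such
  sentences, which bound \<open>\<sigma>\<close> by \<open>c\<close> from above and from
  below.\<close>

lemma complete_theory_fm_val_eq:
  fixes M :: "('f, 'p, 'a) mstructure" and U :: "('f, 'p, 'u) mstructure"
  assumes "complete_theory TYPE('n) L T" "models L M T" "models L U T" "\<sigma> \<in> sentences L"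
  shows "fm_val M \<sigma> e = fm_val U \<sigma> e'"
proof -
  obtain N :: "('f, 'p, 'n) mstructure" where N: "is_structure L N" "T = Th L N"
    using assms(1) by (auto simp: complete_theory_def)
  have \<sigma>: "\<sigma> \<in> formulas L" "free_vars \<sigma> = {}" using assms(4) by (auto simp: sentences_def)
  define c where "c = fm_val N \<sigma> (asg [] [])"
  obtain x where x: "x \<in> univ N" using N(1) by (auto simp: is_structure_def)
  have "fm_val N \<sigma> (\<lambda>_. x) \<in> {0..1}"
    using x by (intro fm_val_in_unit[OF N(1) _ \<sigma>(1)]) (simp add: is_asg_def)
  moreover have "fm_val N \<sigma> (\<lambda>_. x) = c" unfolding c_def using \<sigma>(2) by (intro fm_val_cong) auto
  ultimately have c: "0 \<le> c" "c \<le> 1" by auto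
  have "exceeds_fm c \<sigma> \<in> T" "lacks_fm c \<sigma> \<in> T"
    using c \<sigma> unfolding N(2) Th_def sentences_def
    by (auto simp: exceeds_fm_in_formulas lacks_fm_in_formulas fm_val_exceeds fm_val_lacks c_def)
      (auto simp: exceeds_fm_def lacks_fm_def)
  then have "max 0 (fm_val M \<sigma> (asg [] []) - c) = 0" "max 0 (c - fm_val M \<sigma> (asg [] [])) = 0"
    "max 0 (fm_val U \<sigma> (asg [] []) - c) = 0" "max 0 (c - fm_val U \<sigma> (asg [] [])) = 0"
    using assms(2,3) unfolding models_def fm_val_exceeds[symmetric] fm_val_lacks[symmetric] by blast+
  then have "fm_val M \<sigma> (asg [] []) = c" "fm_val U \<sigma> (asg [] []) = c" by linarith+
  then show ?thesis
    using fm_val_cong[of \<sigma> e "asg [] []" M] fm_val_cong[of \<sigma> e' "asg [] []" U] \<sigma>(2) by simp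
qed

section \<open>Transfer of finite shattering to the monster model and compactness there\<close>

section \<open>Finite shattering in a model yields the independence property\<close>

text \<open>The copies of a formula share the variables \<open>ys\<close>, tagged 0, while copy
  \<open>i\<close> gets fresh versions, tagged \<open>Suc i\<close>, of all others. Thus many points
  are tested against one parameter.\<close>

definition copy_var :: "nat list \<Rightarrow> nat \<Rightarrow> nat \<Rightarrow> nat" where
  "copy_var ys i v = (if v \<in> set ys then prod_encode (0, v) else prod_encode (Suc i, v))"

lemma inj_copy_var: "inj (copy_var ys i)"
  by (rule injI) (auto simp: copy_var_def split: if_splits)

definition pattern_fm ::
  "('f, 'p) fm \<Rightarrow> nat list \<Rightarrow> real \<Rightarrow> real \<Rightarrow> nat set \<Rightarrow> nat \<Rightarrow> ('f, 'p) fm" where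
  "pattern_fm \<phi> ys r s I i =
     (if i \<in> I then exceeds_fm r else lacks_fm s) (ren_fm (copy_var ys i) \<phi>)"

text \<open>The variables of the \<open>d\<close> points stay free, and every pattern
  \<open>I\<close> has its own infimum over the parameter variables.\<close>

definition shatter_fm :: "('f, 'p) fm \<Rightarrow> nat list \<Rightarrow> real \<Rightarrow> real \<Rightarrow> nat \<Rightarrow> ('f, 'p) fm" where
  "shatter_fm \<phi> ys r s d = conj_fm (map (\<lambda>I. infs_fm (map (\<lambda>v. prod_encode (0, v)) ys)
     (conj_fm (map (pattern_fm \<phi> ys r s I) [0..<d]))) (map set (subseqs [0..<d])))"

lemma pattern_fm_in_formulas:
  "\<phi> \<in> formulas L \<Longrightarrow> 0 \<le> r \<Longrightarrow> s \<le> 1 \<Longrightarrow> pattern_fm \<phi> ys r s I i \<in> formulas L"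
  by (simp add: pattern_fm_def exceeds_fm_in_formulas lacks_fm_in_formulas ren_fm_in_formulas)

lemma pattern_conj_in_formulas:
  "\<phi> \<in> formulas L \<Longrightarrow> 0 \<le> r \<Longrightarrow> s \<le> 1 \<Longrightarrow>
    conj_fm (map (pattern_fm \<phi> ys r s I) [0..<d]) \<in> formulas L"
  by (intro conj_fm_in_formulas) (auto intro: pattern_fm_in_formulas)

lemma shatter_fm_in_formulas:
  "\<phi> \<in> formulas L \<Longrightarrow> 0 \<le> r \<Longrightarrow> s \<le> 1 \<Longrightarrow> shatter_fm \<phi> ys r s d \<in> formulas L"
  unfolding shatter_fm_def
  by (intro conj_fm_in_formulas) (auto intro!: infs_fm_in_formulas pattern_conj_in_formulas)

lemma fm_val_pattern_eq_0:
  "fm_val M (pattern_fm \<phi> ys r s I i) e = 0 \<longleftrightarrow>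
    (if i \<in> I then fm_val M \<phi> (e \<circ> copy_var ys i) \<le> r else s \<le> fm_val M \<phi> (e \<circ> copy_var ys i))"
  by (auto simp: pattern_fm_def fm_val_exceeds fm_val_lacks fm_val_ren[OF inj_copy_var] max_def)

lemma fm_val_shatter_eq_0:
  assumes "is_structure L M" "is_asg M e" "\<phi> \<in> formulas L" "0 \<le> r" "s \<le> 1"
  shows "fm_val M (shatter_fm \<phi> ys r s d) e = 0 \<longleftrightarrow>
    (\<forall>I\<subseteq>{..<d}. fm_val M (infs_fm (map (\<lambda>v. prod_encode (0, v)) ys)
       (conj_fm (map (pattern_fm \<phi> ys r s I) [0..<d]))) e = 0)"
proof -
  have "set ` set (subseqs [0..<d]) = Pow {..<d}"
    by (simp add: subseqs_powset atLeast0LessThan)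
  then have Pow: "(\<forall>I\<subseteq>{..<d}. P I) \<longleftrightarrow> (\<forall>l\<in>set (subseqs [0..<d]). P (set l))" for P
    by (metis (no_types, lifting) PowD PowI imageE imageI)
  show ?thesis
    unfolding shatter_fm_def using assms
    by (subst fm_val_conj_eq_0[OF assms(1,2)])
      (auto simp: Pow intro!: infs_fm_in_formulas pattern_conj_in_formulas)
qed

text \<open>The closure of \<open>shatter_fm\<close> by infima has value 0 in \<open>M\<close>,
  hence in \<open>U\<close>. Saturation yields first one sequence of points for all
  \<open>d\<close>, and then a parameter for each set \<open>I\<close>, finite or not.\<close>

lemma shattered_in_model_imp_has_IP:
  fixes M :: "('f, 'p, 'a) mstructure" and U :: "('f, 'p, 'u) mstructure"
  assumes T: "complete_theory TYPE('n) L T" and U: "monster_model L T \<kappa> U" and M: "models L M T"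
    and part: "partitioned L \<phi> xs ys" and rs: "0 \<le> r" "r < s" "s \<le> 1"
    and sh: "\<And>d. \<exists>a. (\<forall>i<d. a i \<in> tuples (univ M) (length xs)) \<and>
      shatters_points (\<lambda>a b. inst_val M xs a (\<phi>, ys, b)) (tuples (univ M) (length ys)) r s {..<d::nat} a"
  shows "has_IP U \<phi> xs ys"
proof -
  have \<phi>: "\<phi> \<in> formulas L" "distinct xs" "distinct ys" "set xs \<inter> set ys = {}"
    "free_vars \<phi> \<subseteq> set xs \<union> set ys"
    using part by (auto simp: partitioned_def)
  have strM: "is_structure L M" using M by (simp add: models_def)
  have U': "saturated L \<kappa> U" "natLeq <o \<kappa>" "models L U T"
    using U by (auto simp: monster_model_def)
  then have strU: "is_structure L U" by (simp add: models_def)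
  let ?\<theta> = "shatter_fm \<phi> ys r s"
  let ?c = "\<lambda>I d. conj_fm (map (pattern_fm \<phi> ys r s I) [0..<d])"
  define ys' where "ys' = map (\<lambda>v. prod_encode (0, v)) ys"
  have \<theta>: "?\<theta> d \<in> formulas L" for d using shatter_fm_in_formulas[OF \<phi>(1) rs(1,3)] .
  have c: "?c I d \<in> formulas L" for I d using pattern_conj_in_formulas[OF \<phi>(1) rs(1,3)] .
  have c_eq_0U: "fm_val U (?c I d) e = 0 \<longleftrightarrow> (\<forall>i<d. fm_val U (pattern_fm \<phi> ys r s I i) e = 0)"
    if "is_asg U e" for e I d
    using that pattern_fm_in_formulas[OF \<phi>(1) rs(1,3)]
    by (subst fm_val_conj_eq_0[OF strU that]) auto
  have \<theta>_eq_0U: "fm_val U (?\<theta> d) e = 0 \<longleftrightarrow>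
      (\<forall>I\<subseteq>{..<d}. \<exists>e'. is_asg U e' \<and> (\<forall>v. v \<notin> set ys' \<longrightarrow> e' v = e v) \<and> fm_val U (?c I d) e' = 0)"
    if e: "is_asg U e" for e d
  proof -
    have "fm_val U (infs_fm ys' (?c I d)) e = 0 \<longleftrightarrow>
        (\<exists>e'. is_asg U e' \<and> (\<forall>v. v \<notin> set ys' \<longrightarrow> e' v = e v) \<and> fm_val U (?c I d) e' = 0)" for I
      using infs_attained[OF U'(1,2) strU e c[of I d], of ys']
        fm_val_infs_eq_0I[OF strU e c[of I d], of _ ys'] by blast
    then show ?thesis
      using fm_val_shatter_eq_0[OF strU e \<phi>(1) rs(1,3), of ys d] by (simp add: ys'_def)
  qed
  have satM: "\<exists>e. is_asg M e \<and> fm_val M (?\<theta> d) e = 0" for d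
  proof -
    obtain x where x: "x \<in> univ M" using strM by (auto simp: is_structure_def)
    obtain a where a: "\<And>i. i < d \<Longrightarrow> a i \<in> tuples (univ M) (length xs)"
      and shat: "shatters_points (\<lambda>a b. inst_val M xs a (\<phi>, ys, b)) (tuples (univ M) (length ys)) r s {..<d} a"
      using sh[of d] by blast
    have a_map: "map (asg xs (a i)) xs = a i" if "i < d" for i
      using a[OF that] \<phi>(2) by (intro map_asg) (auto simp: tuples_def)
    have a_in: "asg xs (a i) v \<in> univ M" if "i < d" "v \<in> set xs" for i v
    proof -
      have "asg xs (a i) v \<in> set (map (asg xs (a i)) xs)" using that(2) by auto
      then show ?thesis using a[OF that(1)] a_map[OF that(1)] by (auto simp: tuples_def)
    qed
    \<comment> \<open>A variable tagged \<open>Suc i\<close> receives the matching entry of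
      \<open>a i\<close>; \<open>x\<close> fills all other places.\<close>
    define e where "e u = (case prod_decode u of
      (0, v) \<Rightarrow> x | (Suc i, v) \<Rightarrow> if i < d \<and> v \<in> set xs then asg xs (a i) v else x)" for u
    have e: "is_asg M e" using x a_in by (auto simp: is_asg_def e_def split: prod.split nat.split)
    have "fm_val M (infs_fm ys' (?c I d)) e = 0" if I: "I \<subseteq> {..<d}" for I
    proof -
      obtain b where b: "b \<in> tuples (univ M) (length ys)"
        "\<And>i. i \<in> I \<Longrightarrow> inst_val M xs (a i) (\<phi>, ys, b) \<le> r"
        "\<And>i. i \<in> {..<d} - I \<Longrightarrow> s \<le> inst_val M xs (a i) (\<phi>, ys, b)"
        using shat[unfolded shatters_points_def, rule_format, OF I] by blast
      have b_map: "map (asg ys b) ys = b" using b(1) \<phi>(3) by (intro map_asg) (auto simp: tuples_def)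
      have b_in: "asg ys b v \<in> univ M" if "v \<in> set ys" for v
      proof -
        have "asg ys b v \<in> set (map (asg ys b) ys)" using that by auto
        then show ?thesis using b(1) b_map by (auto simp: tuples_def)
      qed
      define e' where "e' u = (if u \<in> set ys' then asg ys b (snd (prod_decode u)) else e u)" for u
      have e': "is_asg M e'" using e b_in by (auto simp: is_asg_def e'_def ys'_def)
      have e'_val: "fm_val M \<phi> (e' \<circ> copy_var ys i) = inst_val M xs (a i) (\<phi>, ys, b)" if "i < d" for i
      proof -
        have "inst_val M xs (map (asg xs (a i)) xs) (\<phi>, ys, map (asg ys b) ys)
            = fm_val M \<phi> (e' \<circ> copy_var ys i)"
          using that \<phi>(4) by (intro inst_val_map[OF part]) (auto simp: e'_def e_def ys'_def copy_var_def)
        then show ?thesis using a_map[OF that] b_map by simp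
      qed
      have "fm_val M (?c I d) e' = 0"
        using b(2,3) e'_val
        by (subst fm_val_conj_eq_0[OF strM e'])
          (auto simp: fm_val_pattern_eq_0 intro: pattern_fm_in_formulas[OF \<phi>(1) rs(1,3)])
      then show ?thesis
        by (intro fm_val_infs_eq_0I[OF strM e c e']) (auto simp: e'_def)
    qed
    then have "fm_val M (?\<theta> d) e = 0"
      using fm_val_shatter_eq_0[OF strM e \<phi>(1) rs(1,3), of ys d] by (simp add: ys'_def)
    then show ?thesis using e by blast
  qed
  have satU: "\<exists>e. is_asg U e \<and> fm_val U (?\<theta> d) e = 0" for d
  proof -
    \<comment> \<open>Quantifying away all free variables gives a sentence, to which elementary
      equivalence applies.\<close>
    define vs where "vs = sorted_list_of_set (free_vars (?\<theta> d))"
    have "set vs = free_vars (?\<theta> d)" by (simp add: vs_def finite_free_vars)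
    then have sent: "infs_fm vs (?\<theta> d) \<in> sentences L"
      using \<theta> by (simp add: sentences_def infs_fm_in_formulas free_vars_infs_fm)
    obtain e where e: "is_asg M e" "fm_val M (?\<theta> d) e = 0" using satM by blast
    obtain y where "y \<in> univ U" using strU by (auto simp: is_structure_def)
    then have y: "is_asg U (\<lambda>_. y)" by (simp add: is_asg_def)
    have "fm_val M (infs_fm vs (?\<theta> d)) e = 0"
      using e by (intro fm_val_infs_eq_0I[OF strM e(1) \<theta> e(1)]) auto
    then have "fm_val U (infs_fm vs (?\<theta> d)) (\<lambda>_. y) = 0"
      using complete_theory_fm_val_eq[OF T M U'(3) sent] by metis
    then show ?thesis using infs_attained[OF U'(1,2) strU y \<theta>] by blast
  qed
  \<comment> \<open>A pattern below \<open>d\<close> is also one below \<open>d'\<close>, where its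
    parameter meets more conditions.\<close>
  have monoU: "fm_val U (?\<theta> d) e = 0"
    if le: "d \<le> d'" and e: "is_asg U e" and zero: "fm_val U (?\<theta> d') e = 0" for d d' e
    unfolding \<theta>_eq_0U[OF e]
  proof (intro allI impI)
    fix I assume "I \<subseteq> {..<d}"
    then have "I \<subseteq> {..<d'}" using le by auto
    then obtain e' where e': "is_asg U e'" "\<forall>v. v \<notin> set ys' \<longrightarrow> e' v = e v" "fm_val U (?c I d') e' = 0"
      using zero unfolding \<theta>_eq_0U[OF e] by blast
    then have "fm_val U (?c I d) e' = 0" using le by (simp add: c_eq_0U)
    then show "\<exists>e'. is_asg U e' \<and> (\<forall>v. v \<notin> set ys' \<longrightarrow> e' v = e v) \<and> fm_val U (?c I d) e' = 0"
      using e' by blast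
  qed
  have "\<exists>e. is_asg U e \<and> (\<forall>d. fm_val U (?\<theta> d) e = 0)"
  proof (rule saturated_asg_sequence[OF U'(1,2) strU])
    show "?\<theta> d \<in> formulas L" for d by (rule \<theta>)
    show "fm_val U (?\<theta> d) e = 0"
      if "d \<le> d'" "is_asg U e" "fm_val U (?\<theta> d') e = 0" for d d' e
      using that by (rule monoU)
    show "\<exists>e. is_asg U e \<and> fm_val U (?\<theta> d) e = 0" for d by (rule satU)
  qed
  then obtain e where e: "is_asg U e" "\<And>d. fm_val U (?\<theta> d) e = 0" by blast
  define a where "a i = map (\<lambda>v. e (prod_encode (Suc i, v))) xs" for i
  have a: "a i \<in> tuples (univ U) (length xs)" for i
    using e(1) by (auto simp: a_def tuples_def is_asg_def)
  have "\<exists>b\<in>tuples (univ U) (length ys).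
      (\<forall>i\<in>I. inst_val U xs (a i) (\<phi>, ys, b) \<le> r) \<and> (\<forall>i. i \<notin> I \<longrightarrow> s \<le> inst_val U xs (a i) (\<phi>, ys, b))"
    for I
  proof -
    \<comment> \<open>So far only finite patterns have parameters. A finite part of the type sees
      \<open>I\<close> only below some \<open>d\<close>, so the parameter for
      \<open>I \<inter> {..<d}\<close> satisfies it.\<close>
    have "\<exists>e'. is_asg U e' \<and> (\<forall>v. v \<notin> set ys' \<longrightarrow> e' v = e v) \<and>
        (\<forall>\<psi>\<in>range (pattern_fm \<phi> ys r s I). fm_val U \<psi> e' = 0)"
    proof (rule saturated_asg[OF U'(1,2) e(1)])
      show "range (pattern_fm \<phi> ys r s I) \<subseteq> formulas L"
        using pattern_fm_in_formulas[OF \<phi>(1) rs(1,3)] by auto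
      fix \<Gamma>\<^sub>0 assume "finite \<Gamma>\<^sub>0" "\<Gamma>\<^sub>0 \<subseteq> range (pattern_fm \<phi> ys r s I)"
      then obtain C where C: "finite C" "\<Gamma>\<^sub>0 = pattern_fm \<phi> ys r s I ` C"
        using finite_subset_image by metis
      obtain d where d: "\<And>i. i \<in> C \<Longrightarrow> i < d"
        using C(1) by (meson finite_nat_set_iff_bounded)
      have "\<exists>e'. is_asg U e' \<and> (\<forall>v. v \<notin> set ys' \<longrightarrow> e' v = e v) \<and> fm_val U (?c (I \<inter> {..<d}) d) e' = 0"
        using e(2)[of d, unfolded \<theta>_eq_0U[OF e(1)], rule_format, of "I \<inter> {..<d}"] by simp
      then obtain e' where e': "is_asg U e'" "\<forall>v. v \<notin> set ys' \<longrightarrow> e' v = e v"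
        "fm_val U (?c (I \<inter> {..<d}) d) e' = 0"
        by (elim exE conjE)
      have "fm_val U (pattern_fm \<phi> ys r s (I \<inter> {..<d}) i) e' = 0" if "i < d" for i
        using e'(3) that unfolding c_eq_0U[OF e'(1)] by blast
      moreover have "pattern_fm \<phi> ys r s (I \<inter> {..<d}) i = pattern_fm \<phi> ys r s I i" if "i < d" for i
        using that by (simp add: pattern_fm_def)
      ultimately show "\<exists>e'. is_asg U e' \<and> (\<forall>v. v \<notin> set ys' \<longrightarrow> e' v = e v) \<and> (\<forall>\<psi>\<in>\<Gamma>\<^sub>0. fm_val U \<psi> e' = 0)"
        using e'(1,2) C(2) d by (intro exI[of _ e']) auto
    qed
    then obtain e' where e': "is_asg U e'" "\<And>v. v \<notin> set ys' \<Longrightarrow> e' v = e v"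
      "\<And>i. fm_val U (pattern_fm \<phi> ys r s I i) e' = 0"
      by auto
    let ?b = "map (\<lambda>v. e' (prod_encode (0, v))) ys"
    have "e' (prod_encode (Suc i, v)) = e (prod_encode (Suc i, v))" for i v
      by (rule e'(2)) (auto simp: ys'_def)
    then have "inst_val U xs (a i) (\<phi>, ys, ?b) = fm_val U \<phi> (e' \<circ> copy_var ys i)" for i
      unfolding a_def using \<phi>(4) by (intro inst_val_map[OF part]) (auto simp: copy_var_def)
    moreover have "?b \<in> tuples (univ U) (length ys)"
      using e'(1) by (auto simp: tuples_def is_asg_def)
    ultimately show ?thesis
      using e'(3) unfolding fm_val_pattern_eq_0 by (intro bexI[of _ ?b]) (auto split: if_splits)
  qed
  then show ?thesis unfolding has_IP_def using rs a by blast
qed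

lemma inst_val_in_unit:
  assumes "is_structure L M" "partitioned L \<phi> xs ys"
    and "a \<in> tuples (univ M) (length xs)" "b \<in> tuples (univ M) (length ys)"
  shows "inst_val M xs a (\<phi>, ys, b) \<in> {0..1}"
proof -
  obtain x where x: "x \<in> univ M" using assms(1) by (auto simp: is_structure_def)
  let ?zs = "xs @ ys"
  have "distinct ?zs" "length (a @ b) = length ?zs" "set (a @ b) \<subseteq> univ M"
    using assms by (auto simp: partitioned_def tuples_def)
  then have "map (asg ?zs (a @ b)) ?zs = a @ b" by (intro map_asg)
  then have "asg ?zs (a @ b) ` set ?zs \<subseteq> univ M"
    using \<open>set (a @ b) \<subseteq> univ M\<close> by (metis set_map)
  \<comment> \<open>\<open>asg\<close> is meaningless off \<open>?zs\<close>, so \<open>x\<close>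
    replaces it there without affecting the value of \<open>\<phi>\<close>.\<close>
  then have asg: "is_asg M (\<lambda>v. if v \<in> set ?zs then asg ?zs (a @ b) v else x)"
    using x by (auto simp: is_asg_def)
  have "inst_val M xs a (\<phi>, ys, b) = fm_val M \<phi> (\<lambda>v. if v \<in> set ?zs then asg ?zs (a @ b) v else x)"
    unfolding inst_val_def prod.case using assms(2) by (intro fm_val_cong) (auto simp: partitioned_def)
  then show ?thesis using fm_val_in_unit[OF assms(1) asg] assms(2) by (simp add: partitioned_def)
qed

theorem theorem4p4:
  fixes L :: "('f, 'p) signature"
    and T :: "('f, 'p) fm set"
    and \<kappa> :: "'k rel"
    and U :: "('f, 'p, 'u) mstructure"
    and M :: "('f, 'p, 'a) mstructure"
    and \<phi> :: "('f, 'p) fm"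
    and xs ys :: "nat list"
    and r s :: real
  assumes "complete_theory TYPE('n) L T"
    and "monster_model L T \<kappa> U"
    and "NIP L U"
    and "models L M T"
    and "partitioned L \<phi> xs ys"
    and "r < s" and "s \<le> 1"
  shows "\<exists>n. \<not> (\<exists>\<mu>. (\<forall>i\<in>{1..n}. \<mu> i \<in> average_measures M xs) \<and> shattered M \<phi> ys r s n \<mu>)"
proof (rule ccontr)
  let ?X = "tuples (univ M) (length xs)" and ?Y = "tuples (univ M) (length ys)"
  let ?F = "\<lambda>a b. inst_val M xs a (\<phi>, ys, b)"
  assume "\<not> ?thesis"
  then have all: "\<exists>\<mu>. (\<forall>i\<in>{1..n}. \<mu> i \<in> average_measures M xs) \<and> shattered M \<phi> ys r s n \<mu>" for n :: nat
    by blast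
  \<comment> \<open>The measures are replaced by lists of points that define them, as the abstract
    lemma requires.\<close>
  have sh: "\<exists>as. (\<forall>i\<in>{1..n}. as i \<noteq> [] \<and> set (as i) \<subseteq> ?X) \<and>
      shatters_points (\<lambda>as b. (1 / real (length as)) * (\<Sum>j<length as. ?F (as ! j) b)) ?Y r s {1..n} as"
    for n :: nat
  proof -
    obtain \<mu> where \<mu>: "\<And>i. i \<in> {1..n} \<Longrightarrow> \<mu> i \<in> average_measures M xs" "shattered M \<phi> ys r s n \<mu>"
      using all by blast
    have "\<forall>i\<in>{1..n}. \<exists>as. as \<noteq> [] \<and> set as \<subseteq> ?X \<and> \<mu> i = Ave M xs as"
      using \<mu>(1) unfolding average_measures_def by blast
    then obtain as where as: "\<And>i. i \<in> {1..n} \<Longrightarrow> as i \<noteq> [] \<and> set (as i) \<subseteq> ?X \<and> \<mu> i = Ave M xs (as i)"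
      by metis
    have \<mu>_eq: "\<mu> i (\<phi>, ys, b) = (1 / real (length (as i))) * (\<Sum>j<length (as i). ?F (as i ! j) b)"
      if "i \<in> {1..n}" for i b using as[OF that] by (simp add: Ave_def)
    have "shatters_points (\<lambda>as b. (1 / real (length as)) * (\<Sum>j<length as. ?F (as ! j) b)) ?Y r s {1..n} as"
      unfolding shatters_points_def
    proof (intro allI impI)
      fix I assume I: "I \<subseteq> {1..n}"
      then obtain b where b: "b \<in> ?Y" "\<forall>i\<in>I. \<mu> i (\<phi>, ys, b) \<le> r" "\<forall>i\<in>{1..n} - I. s \<le> \<mu> i (\<phi>, ys, b)"
        using \<mu>(2) unfolding shattered_def by blast
      have "\<forall>i\<in>I. (1 / real (length (as i))) * (\<Sum>j<length (as i). ?F (as i ! j) b) \<le> r"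
        using b(2) I \<mu>_eq[of _ b] by (metis subsetD)
      moreover have "\<forall>i\<in>{1..n} - I. s \<le> (1 / real (length (as i))) * (\<Sum>j<length (as i). ?F (as i ! j) b)"
        using b(3) \<mu>_eq[of _ b] by (metis DiffD1)
      ultimately show "\<exists>b\<in>?Y. (\<forall>i\<in>I. (1 / real (length (as i))) * (\<Sum>j<length (as i). ?F (as i ! j) b) \<le> r) \<and>
          (\<forall>i\<in>{1..n} - I. s \<le> (1 / real (length (as i))) * (\<Sum>j<length (as i). ?F (as i ! j) b))"
        using b(1) by blast
    qed
    then show ?thesis using as by blast
  qed
  have strM: "is_structure L M" using assms(4) by (simp add: models_def)
  \<comment> \<open>The new thresholds may be unrelated to \<open>r\<close> and \<open>s\<close>;
    this is harmless, as \<open>NIP\<close> excludes all admissible pairs.\<close>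
  obtain r' s' where rs': "0 \<le> r'" "r' < s'" "s' \<le> 1"
    and pts: "\<And>d. \<exists>a. (\<forall>i<d. a i \<in> ?X) \<and> shatters_points ?F ?Y r' s' {..<d::nat} a"
  proof -
    have "\<exists>r' s'. 0 \<le> r' \<and> r' < s' \<and> s' \<le> 1 \<and>
        (\<forall>d. \<exists>a. (\<forall>i<d. a i \<in> ?X) \<and> shatters_points ?F ?Y r' s' {..<d::nat} a)"
    proof (rule averages_shattered_imp_points_shattered[OF _ assms(6) sh])
      show "?F a b \<in> {0..1}" if "a \<in> ?X" "b \<in> ?Y" for a b
        using that by (rule inst_val_in_unit[OF strM assms(5)])
    qed
    then show ?thesis using that by blast
  qed
  have "has_IP U \<phi> xs ys"
    by (rule shattered_in_model_imp_has_IP[OF assms(1,2,4,5) rs' pts])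
  then show False using assms(3,5) by (auto simp: NIP_def)
qed

end
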